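(* Let $j_X:X\hookrightarrow H_\ell(\tilde X)$, $x\mapsto\bullet_x$, be the natural embedding. Then the quintuple $(H_\ell(\tilde X),\, m_{RT},\, 1,\, \Delta_\epsilon,\, B^+)$ together with $j_X$ is the free cocycle $\epsilon$-unitary bialgebra on the set $X$.
   Context: Let $\mathbf{k}$ be a commutative ring with unit; linear maps and tensor products are over $\mathbf{k}$. For an associative algebra $A$, view $A\otimes A$ as an $A$-bimodule via $a\cdot(b\otimes c):=ab\otimes c$ and $(b\otimes c)\cdot a:=b\otimes ca$. An infinitesimal unitary bialgebra ($\epsilon$-unitary bialgebra) is a quadruple $(A,m,1,\Delta)$ where $(A,m,1)$ is a unitary associative algebra, $(A,\Delta)$ is a coassociative coalgebra (no counit required), and $\Delta(ab)=a\cdot\Delta(b)+\Delta(a)\cdot b$ for all $a,b\in A$. An $\epsilon$-unitary bialgebra morphism is a map that is both a unitary algebra morphism and a coalgebra morphism (compatible with the coproducts). An operated $\epsilon$-unitary bialgebra $(H,m,1,\Delta,P)$ is an $\epsilon$-unitary bialgebra $(H,m,1,\Delta)$ with a linear operator $P:H\to H$. A morphism of operated $\epsilon$-unitary bialgebras $\psi:(A,P_A)\to(B,P_B)$ is an $\epsilon$-unitary bialgebra morphism with $\psi P_A=P_B\psi$. A cocycle $\epsilon$-unitary bialgebra is an operated $\epsilon$-unitary bialgebra with $\Delta P=\mathrm{id}\otimes 1+(\mathrm{id}\otimes P)\Delta$, i.e. $\Delta(P(a))=a\otimes 1+(\mathrm{id}\otimes P)\Delta(a)$ for all $a\in H$.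 The free cocycle $\epsilon$-unitary bialgebra on a set $X$ is a cocycle $\epsilon$-unitary bialgebra $(H_X,m_X,1_X,\Delta_X,P_X)$ together with a set map $j_X:X\to H_X$ such that, for any cocycle $\epsilon$-unitary bialgebra $(H,m,1,\Delta,P)$ and any set map $f:X\to H$ with $\Delta(f(x))=1\otimes 1$ for all $x\in X$, there is a unique morphism $\bar f:H_X\to H$ of operated $\epsilon$-unitary bialgebras with $\bar f j_X=f$. Let $X$ be a set, $\sigma\notin X$ a symbol, and $\tilde X:=X\sqcup\{\sigma\}$. Consider planar rooted trees whose vertices are decorated by elements of $\tilde X$ in such a way that elements of $X$ decorate leaves only (all internal vertices, and possibly some leaves, are decorated by $\sigma$; the vertex of a one-vertex tree counts as a leaf). Let $\mathcal{T}_\ell(\tilde X)$ be the set of such trees, including by convention the empty tree $1$. Let $\mathcal{F}_\ell(\tilde X)$ be the free monoid generated by the nonempty such trees (planar decorated rooted forests, with concatenation as product and $1$ as identity), and let $H_\ell(\tilde X):=\mathbf{k}\mathcal{F}_\ell(\tilde X)$ be the free $\mathbf{k}$-module on it, with the linearly extended concatenation product $m_{RT}$ and unit $1$. For $x\in\tilde X$, $\bullet_x$ is the one-vertex tree decorated by $x$. $B^+:H_\ell(\tilde X)\to H_\ell(\tilde X)$ is the linear grafting map with $B^+(1)=\bullet_\sigma$ that sends a forest to the tree obtained by grafting it onto a new root decorated by $\sigma$. Every nonempty tree in $\mathcal{T}_\ell(\tilde X)$ is either $\bullet_x$ with $x\in X$ or $B^+(\bar F)$ for a unique forest $\bar F\in\mathcal{F}_\ell(\tilde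 X)$. The linear map $\Delta_\epsilon:H_\ell(\tilde X)\to H_\ell(\tilde X)\otimes H_\ell(\tilde X)$ is defined recursively on forests by: $\Delta_\epsilon(1)=0$; $\Delta_\epsilon(\bullet_x)=1\otimes 1$ for $x\in X$; $\Delta_\epsilon(B^+(\bar F))=\bar F\otimes 1+(\mathrm{id}\otimes B^+)\Delta_\epsilon(\bar F)$ for $\bar F\in\mathcal{F}_\ell(\tilde X)$; and $\Delta_\epsilon(T_1T_2\cdots T_m)=T_1\cdot\Delta_\epsilon(T_2\cdots T_m)+\Delta_\epsilon(T_1)\cdot(T_2\cdots T_m)$ for nonempty trees $T_1,\dots,T_m\in\mathcal{T}_\ell(\tilde X)$, $m\ge 2$. *)

theory Defs
  imports "HOL-Algebra.Module" "HOL-Algebra.AbelCoset"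
begin

section \<open>Linear maps and free modules\<close>

definition linear_maps ::
  "('r, 'q) ring_scheme \<Rightarrow> ('r, 'a, 'm) module_scheme \<Rightarrow> ('r, 'b, 'n) module_scheme \<Rightarrow> ('a \<Rightarrow> 'b) set"
  where "linear_maps R M N =
    {f \<in> carrier M \<rightarrow> carrier N.
       (\<forall>x\<in>carrier M. \<forall>y\<in>carrier M. f (x \<oplus>\<^bsub>M\<^esub> y) = f x \<oplus>\<^bsub>N\<^esub> f y) \<and>
       (\<forall>r\<in>carrier R. \<forall>x\<in>carrier M. f (r \<odot>\<^bsub>M\<^esub> x) = r \<odot>\<^bsub>N\<^esub> f x)}"

text \<open>
  The free module on a set \<open>B\<close> consists of the finitely supported functions on \<open>B\<close>, extended by
  zero outside \<open>B\<close>. It is used as a mere module: its ring fields \<open>mult\<close> and \<open>one\<close> are irrelevant.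
\<close>

definition free_module :: "('r, 'q) ring_scheme \<Rightarrow> 'b set \<Rightarrow> ('r, 'b \<Rightarrow> 'r) module"
  where "free_module R B =
    \<lparr>carrier = {c. (\<forall>b\<in>B. c b \<in> carrier R) \<and> (\<forall>b. b \<notin> B \<longrightarrow> c b = \<zero>\<^bsub>R\<^esub>) \<and> finite {b. c b \<noteq> \<zero>\<^bsub>R\<^esub>}},
     mult = undefined, one = undefined,
     zero = (\<lambda>b. \<zero>\<^bsub>R\<^esub>), add = (\<lambda>c d b. c b \<oplus>\<^bsub>R\<^esub> d b), smult = (\<lambda>r c b. r \<otimes>\<^bsub>R\<^esub> c b)\<rparr>"

definition basis_elem :: "('r, 'q) ring_scheme \<Rightarrow> 'b \<Rightarrow> 'b \<Rightarrow> 'r"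
  where "basis_elem R b = (\<lambda>b'. if b' = b then \<one>\<^bsub>R\<^esub> else \<zero>\<^bsub>R\<^esub>)"

text \<open>The linear extension to a free module of a map \<open>\<phi>\<close> given on the basis.\<close>

definition lin_ext ::
  "('r, 'q) ring_scheme \<Rightarrow> ('r, 'n, 'm) module_scheme \<Rightarrow> ('b \<Rightarrow> 'n) \<Rightarrow> ('b \<Rightarrow> 'r) \<Rightarrow> 'n"
  where "lin_ext R N \<phi> c = (\<Oplus>\<^bsub>N\<^esub>b\<in>{b. c b \<noteq> \<zero>\<^bsub>R\<^esub>}. c b \<odot>\<^bsub>N\<^esub> \<phi> b)"


section \<open>Tensor products of modules\<close>

text \<open>
  The tensor product of \<open>M\<close> and \<open>N\<close> is the quotient of the free module on
  \<open>carrier M \<times> carrier N\<close> by the submodule generated by the bilinearity relations;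
  its elements are cosets of that submodule.
\<close>

type_synonym ('r, 'm, 'n) tensor = "('m \<times> 'n \<Rightarrow> 'r) set"

abbreviation tensor_free ::
  "('r, 'q) ring_scheme \<Rightarrow> ('r, 'm, 'e) module_scheme \<Rightarrow> ('r, 'n, 'f) module_scheme
    \<Rightarrow> ('r, 'm \<times> 'n \<Rightarrow> 'r) module"
  where "tensor_free R M N \<equiv> free_module R (carrier M \<times> carrier N)"

inductive_set tensor_gens ::
  "('r, 'q) ring_scheme \<Rightarrow> ('r, 'm, 'e) module_scheme \<Rightarrow> ('r, 'n, 'f) module_scheme
    \<Rightarrow> ('m \<times> 'n \<Rightarrow> 'r) set"
  for R :: "('r, 'q) ring_scheme" and M :: "('r, 'm, 'e) module_scheme"
    and N :: "('r, 'n, 'f) module_scheme"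
  where
    add_left: "\<lbrakk>x \<in> carrier M; x' \<in> carrier M; y \<in> carrier N\<rbrakk> \<Longrightarrow>
      basis_elem R (x \<oplus>\<^bsub>M\<^esub> x', y) \<ominus>\<^bsub>tensor_free R M N\<^esub>
        (basis_elem R (x, y) \<oplus>\<^bsub>tensor_free R M N\<^esub> basis_elem R (x', y)) \<in> tensor_gens R M N"
  | add_right: "\<lbrakk>x \<in> carrier M; y \<in> carrier N; y' \<in> carrier N\<rbrakk> \<Longrightarrow>
      basis_elem R (x, y \<oplus>\<^bsub>N\<^esub> y') \<ominus>\<^bsub>tensor_free R M N\<^esub>
        (basis_elem R (x, y) \<oplus>\<^bsub>tensor_free R M N\<^esub> basis_elem R (x, y')) \<in> tensor_gens R M N"
  | smult_left: "\<lbrakk>r \<in> carrier R; x \<in> carrier M; y \<in> carrier N\<rbrakk> \<Longrightarrow>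
      basis_elem R (r \<odot>\<^bsub>M\<^esub> x, y) \<ominus>\<^bsub>tensor_free R M N\<^esub>
        (r \<odot>\<^bsub>tensor_free R M N\<^esub> basis_elem R (x, y)) \<in> tensor_gens R M N"
  | smult_right: "\<lbrakk>r \<in> carrier R; x \<in> carrier M; y \<in> carrier N\<rbrakk> \<Longrightarrow>
      basis_elem R (x, r \<odot>\<^bsub>N\<^esub> y) \<ominus>\<^bsub>tensor_free R M N\<^esub>
        (r \<odot>\<^bsub>tensor_free R M N\<^esub> basis_elem R (x, y)) \<in> tensor_gens R M N"

definition tensor_rel ::
  "('r, 'q) ring_scheme \<Rightarrow> ('r, 'm, 'e) module_scheme \<Rightarrow> ('r, 'n, 'f) module_scheme
    \<Rightarrow> ('m \<times> 'n \<Rightarrow> 'r) set"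
  where "tensor_rel R M N = \<Inter>{K. submodule K R (tensor_free R M N) \<and> tensor_gens R M N \<subseteq> K}"

definition tensor_prod ::
  "('r, 'q) ring_scheme \<Rightarrow> ('r, 'm, 'e) module_scheme \<Rightarrow> ('r, 'n, 'f) module_scheme
    \<Rightarrow> ('r, ('r, 'm, 'n) tensor) module"
  where "tensor_prod R M N =
    \<lparr>carrier = a_rcosets\<^bsub>tensor_free R M N\<^esub> (tensor_rel R M N),
     mult = undefined, one = undefined,
     zero = tensor_rel R M N,
     add = set_add (tensor_free R M N),
     smult = (\<lambda>r C. \<Union>c\<in>C. tensor_rel R M N +>\<^bsub>tensor_free R M N\<^esub> (r \<odot>\<^bsub>tensor_free R M N\<^esub> c))\<rparr>"

definition pure_tensor ::
  "('r, 'q) ring_scheme \<Rightarrow> ('r, 'm, 'e) module_scheme \<Rightarrow> ('r, 'n, 'f) module_scheme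
    \<Rightarrow> 'm \<Rightarrow> 'n \<Rightarrow> ('r, 'm, 'n) tensor"
  where "pure_tensor R M N x y = tensor_rel R M N +>\<^bsub>tensor_free R M N\<^esub> basis_elem R (x, y)"

text \<open>
  The linear map out of a tensor product induced by a bilinear map \<open>\<beta>\<close> into \<open>Q\<close>, that is,
  \<open>x \<otimes> y \<mapsto> \<beta> x y\<close>. For bilinear \<open>\<beta>\<close> the value does not depend on the chosen representative.
\<close>

definition tensor_lift ::
  "('r, 'q) ring_scheme \<Rightarrow> ('r, 'p, 'g) module_scheme \<Rightarrow> ('m \<Rightarrow> 'n \<Rightarrow> 'p) \<Rightarrow> ('r, 'm, 'n) tensor \<Rightarrow> 'p"
  where "tensor_lift R Q \<beta> C = lin_ext R Q (\<lambda>(x, y). \<beta> x y) (SOME c. c \<in> C)"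

text \<open>\<open>f \<otimes> g\<close> with values in the tensor product of \<open>M'\<close> and \<open>N'\<close>.\<close>

definition tensor_map ::
  "('r, 'q) ring_scheme \<Rightarrow> ('r, 'm2, 'e) module_scheme \<Rightarrow> ('r, 'n2, 'f) module_scheme
    \<Rightarrow> ('m \<Rightarrow> 'm2) \<Rightarrow> ('n \<Rightarrow> 'n2) \<Rightarrow> ('r, 'm, 'n) tensor \<Rightarrow> ('r, 'm2, 'n2) tensor"
  where "tensor_map R M' N' f g =
    tensor_lift R (tensor_prod R M' N') (\<lambda>x y. pure_tensor R M' N' (f x) (g y))"

text \<open>\<open>(a \<otimes> b) \<otimes> c \<mapsto> a \<otimes> (b \<otimes> c)\<close>\<close>

definition tensor_assoc ::
  "('r, 'q) ring_scheme \<Rightarrow> ('r, 'a, 'e) module_scheme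
    \<Rightarrow> ('r, ('r, 'a, 'a) tensor, 'a) tensor \<Rightarrow> ('r, 'a, ('r, 'a, 'a) tensor) tensor"
  where "tensor_assoc R A =
    (let Q = tensor_prod R A (tensor_prod R A A) in
     tensor_lift R Q (\<lambda>t c.
       tensor_lift R Q (\<lambda>a b. pure_tensor R A (tensor_prod R A A) a (pure_tensor R A A b c)) t))"


section \<open>Cocycle infinitesimal unitary bialgebras\<close>

text \<open>The bimodule structure on \<open>A \<otimes> A\<close>: \<open>a \<cdot> (b \<otimes> c) = ab \<otimes> c\<close> and \<open>(b \<otimes> c) \<cdot> a = b \<otimes> ca\<close>.\<close>

definition left_act ::
  "('r, 'q) ring_scheme \<Rightarrow> ('r, 'a, 'e) module_scheme \<Rightarrow> 'a \<Rightarrow> ('r, 'a, 'a) tensor \<Rightarrow> ('r, 'a, 'a) tensor"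
  where "left_act R A a =
    tensor_lift R (tensor_prod R A A) (\<lambda>b c. pure_tensor R A A (a \<otimes>\<^bsub>A\<^esub> b) c)"

definition right_act ::
  "('r, 'q) ring_scheme \<Rightarrow> ('r, 'a, 'e) module_scheme \<Rightarrow> ('r, 'a, 'a) tensor \<Rightarrow> 'a \<Rightarrow> ('r, 'a, 'a) tensor"
  where "right_act R A t a =
    tensor_lift R (tensor_prod R A A) (\<lambda>b c. pure_tensor R A A b (c \<otimes>\<^bsub>A\<^esub> a)) t"

text \<open>
  The locale \<open>algebra\<close> of HOL-Algebra requires a commutative multiplication, hence the
  following (not necessarily commutative) variant.
\<close>

locale unitary_algebra = module R A + ring A for R (structure) and A (structure) +
  assumes smult_mult_left:
      "\<lbrakk>r \<in> carrier R; x \<in> carrier A; y \<in> carrier A\<rbrakk> \<Longrightarrow>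
        (r \<odot>\<^bsub>A\<^esub> x) \<otimes>\<^bsub>A\<^esub> y = r \<odot>\<^bsub>A\<^esub> (x \<otimes>\<^bsub>A\<^esub> y)"
    and smult_mult_right:
      "\<lbrakk>r \<in> carrier R; x \<in> carrier A; y \<in> carrier A\<rbrakk> \<Longrightarrow>
        x \<otimes>\<^bsub>A\<^esub> (r \<odot>\<^bsub>A\<^esub> y) = r \<odot>\<^bsub>A\<^esub> (x \<otimes>\<^bsub>A\<^esub> y)"

locale eps_unitary_bialgebra = unitary_algebra R A for R (structure) and A (structure) +
  fixes \<Delta>
  assumes comult_linear: "\<Delta> \<in> linear_maps R A (tensor_prod R A A)"
    and coassoc: "a \<in> carrier A \<Longrightarrow>
      tensor_assoc R A (tensor_map R (tensor_prod R A A) A \<Delta> id (\<Delta> a)) =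
      tensor_map R A (tensor_prod R A A) id \<Delta> (\<Delta> a)"
    and comult_mult: "\<lbrakk>a \<in> carrier A; b \<in> carrier A\<rbrakk> \<Longrightarrow>
      \<Delta> (a \<otimes>\<^bsub>A\<^esub> b) = left_act R A a (\<Delta> b) \<oplus>\<^bsub>tensor_prod R A A\<^esub> right_act R A (\<Delta> a) b"

locale operated_eps_unitary_bialgebra =
  eps_unitary_bialgebra R A \<Delta> for R (structure) and A (structure) and \<Delta> +
  fixes P
  assumes operator_linear: "P \<in> linear_maps R A A"

locale cocycle_eps_unitary_bialgebra =
  operated_eps_unitary_bialgebra R A \<Delta> P for R (structure) and A (structure) and \<Delta> and P +
  assumes cocycle: "a \<in> carrier A \<Longrightarrow>
      \<Delta> (P a) = pure_tensor R A A a \<one>\<^bsub>A\<^esub> \<oplus>\<^bsub>tensor_prod R A A\<^esub> tensor_map R A A id P (\<Delta> a)"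

definition operated_eps_morphism ::
  "('r, 'q) ring_scheme
    \<Rightarrow> ('r, 'a, 'e) module_scheme \<Rightarrow> ('a \<Rightarrow> ('r, 'a, 'a) tensor) \<Rightarrow> ('a \<Rightarrow> 'a)
    \<Rightarrow> ('r, 'b, 'f) module_scheme \<Rightarrow> ('b \<Rightarrow> ('r, 'b, 'b) tensor) \<Rightarrow> ('b \<Rightarrow> 'b)
    \<Rightarrow> ('a \<Rightarrow> 'b) \<Rightarrow> bool"
  where "operated_eps_morphism R A \<Delta>\<^sub>A P\<^sub>A B \<Delta>\<^sub>B P\<^sub>B \<psi> \<longleftrightarrow>
    \<psi> \<in> linear_maps R A B \<and>
    \<psi> \<in> ring_hom A B \<and>
    (\<forall>a\<in>carrier A. \<Delta>\<^sub>B (\<psi> a) = tensor_map R B B \<psi> \<psi> (\<Delta>\<^sub>A a)) \<and>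
    (\<forall>a\<in>carrier A. \<psi> (P\<^sub>A a) = P\<^sub>B (\<psi> a))"

text \<open>
  A definition cannot quantify over types; hence the type \<open>'h\<close> of the test objects \<open>H\<close> in the
  universal property is a parameter. Morphisms are functions on carriers, represented as
  extensional functions so that uniqueness means uniqueness on the carrier.
\<close>

definition free_cocycle_eps_unitary_bialgebra ::
  "'h itself \<Rightarrow> ('r, 'q) ring_scheme \<Rightarrow> 'x set
    \<Rightarrow> ('r, 'a, 'e) module_scheme \<Rightarrow> ('a \<Rightarrow> ('r, 'a, 'a) tensor) \<Rightarrow> ('a \<Rightarrow> 'a)
    \<Rightarrow> ('x \<Rightarrow> 'a) \<Rightarrow> bool"
  where "free_cocycle_eps_unitary_bialgebra (T :: 'h itself) R X A \<Delta>\<^sub>A P\<^sub>A j \<longleftrightarrow>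
    cocycle_eps_unitary_bialgebra R A \<Delta>\<^sub>A P\<^sub>A \<and>
    j \<in> X \<rightarrow> carrier A \<and>
    (\<forall>(H :: ('r, 'h) module) \<Delta> P f.
       cocycle_eps_unitary_bialgebra R H \<Delta> P \<longrightarrow>
       f \<in> X \<rightarrow> carrier H \<longrightarrow>
       (\<forall>x\<in>X. \<Delta> (f x) = pure_tensor R H H \<one>\<^bsub>H\<^esub> \<one>\<^bsub>H\<^esub>) \<longrightarrow>
       (\<exists>!\<psi>. \<psi> \<in> extensional (carrier A) \<and>
             operated_eps_morphism R A \<Delta>\<^sub>A P\<^sub>A H \<Delta> P \<psi> \<and>
             (\<forall>x\<in>X. \<psi> (j x) = f x)))"


section \<open>Decorated planar rooted forests\<close>

text \<open>
  A nonempty planar rooted tree is given by the decoration of its root and the list of its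
  subtrees. Forests are lists of nonempty trees, the empty list being the unit (the empty tree).
\<close>

datatype 'd rtree = Node 'd "'d rtree list"

text \<open>Trees decorated by \<open>insert \<sigma> X\<close>, with only \<open>\<sigma>\<close> allowed at internal vertices.\<close>

fun leaf_decorated :: "'d set \<Rightarrow> 'd \<Rightarrow> 'd rtree \<Rightarrow> bool"
  where "leaf_decorated X \<sigma> (Node d ts) \<longleftrightarrow>
    d \<in> insert \<sigma> X \<and> (ts \<noteq> [] \<longrightarrow> d = \<sigma>) \<and> (\<forall>t\<in>set ts. leaf_decorated X \<sigma> t)"

definition forests :: "'d set \<Rightarrow> 'd \<Rightarrow> 'd rtree list set"
  where "forests X \<sigma> = lists {t. leaf_decorated X \<sigma> t}"

definition H_alg :: "('r, 'q) ring_scheme \<Rightarrow> 'd set \<Rightarrow> 'd \<Rightarrow> ('r, 'd rtree list \<Rightarrow> 'r) module"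
  where "H_alg R X \<sigma> =
    (let F = free_module R (forests X \<sigma>) in
     F\<lparr>mult := (\<lambda>a b. lin_ext R F (\<lambda>u. lin_ext R F (\<lambda>v. basis_elem R (u @ v)) b) a),
       one := basis_elem R []\<rparr>)"

definition B_plus ::
  "('r, 'q) ring_scheme \<Rightarrow> 'd set \<Rightarrow> 'd \<Rightarrow> ('d rtree list \<Rightarrow> 'r) \<Rightarrow> 'd rtree list \<Rightarrow> 'r"
  where "B_plus R X \<sigma> = lin_ext R (H_alg R X \<sigma>) (\<lambda>u. basis_elem R [Node \<sigma> u])"

definition single_vertex :: "('r, 'q) ring_scheme \<Rightarrow> 'd \<Rightarrow> 'd rtree list \<Rightarrow> 'r"
  where "single_vertex R x = basis_elem R [Node x []]"

fun Delta_forest ::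
  "('r, 'q) ring_scheme \<Rightarrow> 'd set \<Rightarrow> 'd \<Rightarrow> 'd rtree list
    \<Rightarrow> ('r, 'd rtree list \<Rightarrow> 'r, 'd rtree list \<Rightarrow> 'r) tensor"
  where
    "Delta_forest R X \<sigma> [] = \<zero>\<^bsub>tensor_prod R (H_alg R X \<sigma>) (H_alg R X \<sigma>)\<^esub>"
  | "Delta_forest R X \<sigma> [Node d ts] =
      (let H = H_alg R X \<sigma> in
       if d \<in> X then pure_tensor R H H \<one>\<^bsub>H\<^esub> \<one>\<^bsub>H\<^esub>
       else pure_tensor R H H (basis_elem R ts) \<one>\<^bsub>H\<^esub> \<oplus>\<^bsub>tensor_prod R H H\<^esub>
            tensor_map R H H id (B_plus R X \<sigma>) (Delta_forest R X \<sigma> ts))"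
  | "Delta_forest R X \<sigma> (t # u # us) =
      (let H = H_alg R X \<sigma> in
       left_act R H (basis_elem R [t]) (Delta_forest R X \<sigma> (u # us)) \<oplus>\<^bsub>tensor_prod R H H\<^esub>
       right_act R H (Delta_forest R X \<sigma> [t]) (basis_elem R (u # us)))"

definition Delta_eps ::
  "('r, 'q) ring_scheme \<Rightarrow> 'd set \<Rightarrow> 'd \<Rightarrow> ('d rtree list \<Rightarrow> 'r)
    \<Rightarrow> ('r, 'd rtree list \<Rightarrow> 'r, 'd rtree list \<Rightarrow> 'r) tensor"
  where "Delta_eps R X \<sigma> =
    lin_ext R (tensor_prod R (H_alg R X \<sigma>) (H_alg R X \<sigma>)) (Delta_forest R X \<sigma>)"

end

theory Submission
  imports Defs
begin

text \<open>
  Trees other than the single vertices \<open>x \<in> X\<close> are graftings, so forests are generated from \<open>X\<close>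
  by products and grafting. Hence a morphism out of the forest algebra is determined by its values
  on \<open>X\<close>, and conversely these values extend recursively to forests. The derivation rule and the
  cocycle equation determine the coproduct of products and of graftings. Therefore coassociativity
  of \<open>\<Delta>\<^sub>\<epsilon>\<close> and compatibility of the extension with the coproducts both follow by induction on
  forests. The base case is \<open>\<Delta> x = 1 \<otimes> 1\<close> together with \<open>\<Delta> 1 = 0\<close>, a consequence of the derivation
  rule.
\<close>

section \<open>Linear maps and free modules\<close>

text \<open>Equalities between tensors are reduced to pure tensors, and equalities in the forest
  algebra to basis forests, by making both sides linear. As a tensor is a coset and
  \<open>tensor_lift\<close> evaluates at an arbitrarily chosen representative, each lifted map
  first has to be shown to come from a bilinear one.

  The obstacle is coassociativity of a product. Neither iterated coproduct is a derivation: with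
  \<Delta> a = a' \<otimes> a'' and \<Delta> b = b' \<otimes> b'' (sums understood), both produce on
  ab the extra term a' \<otimes> a''b' \<otimes> b''. The induction closes because this defect is
  the same for the two bracketings. For a grafting, the summand a \<otimes> 1 yields \<Delta> a
  \<otimes> 1 in one bracketing and, as \<Delta> 1 = 0, nothing in the other; there the same term
  comes from a second use of the cocycle equation, underneath id \<otimes> \<Delta>.

  Neither computation refers to forests, so both are done for an arbitrary algebra whose coproduct
  obeys the derivation rule.\<close>

lemma linear_mapsI:
  assumes "\<And>x. x \<in> carrier M \<Longrightarrow> f x \<in> carrier N"
    and "\<And>x y. x \<in> carrier M \<Longrightarrow> y \<in> carrier M \<Longrightarrow> f (x \<oplus>\<^bsub>M\<^esub> y) = f x \<oplus>\<^bsub>N\<^esub> f y"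
    and "\<And>r x. r \<in> carrier R \<Longrightarrow> x \<in> carrier M \<Longrightarrow> f (r \<odot>\<^bsub>M\<^esub> x) = r \<odot>\<^bsub>N\<^esub> f x"
  shows "f \<in> linear_maps R M N"
  using assms by (auto simp: linear_maps_def)

lemma linear_maps_closed: "f \<in> linear_maps R M N \<Longrightarrow> x \<in> carrier M \<Longrightarrow> f x \<in> carrier N"
  by (auto simp: linear_maps_def)

lemma linear_maps_add:
  "f \<in> linear_maps R M N \<Longrightarrow> x \<in> carrier M \<Longrightarrow> y \<in> carrier M \<Longrightarrow>
    f (x \<oplus>\<^bsub>M\<^esub> y) = f x \<oplus>\<^bsub>N\<^esub> f y"
  by (auto simp: linear_maps_def)

lemma linear_maps_smult:
  "f \<in> linear_maps R M N \<Longrightarrow> r \<in> carrier R \<Longrightarrow> x \<in> carrier M \<Longrightarrow> f (r \<odot>\<^bsub>M\<^esub> x) = r \<odot>\<^bsub>N\<^esub> f x"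
  by (auto simp: linear_maps_def)

lemmas linear_maps_simps = linear_maps_closed linear_maps_add linear_maps_smult

lemma linear_maps_zero:
  assumes "module R M" "module R N" "f \<in> linear_maps R M N"
  shows "f \<zero>\<^bsub>M\<^esub> = \<zero>\<^bsub>N\<^esub>"
proof -
  interpret M: module R M by fact
  interpret N: module R N by fact
  have "f (\<zero>\<^bsub>R\<^esub> \<odot>\<^bsub>M\<^esub> \<zero>\<^bsub>M\<^esub>) = \<zero>\<^bsub>R\<^esub> \<odot>\<^bsub>N\<^esub> f \<zero>\<^bsub>M\<^esub>"
    using assms(3) by (intro linear_maps_smult) auto
  then show ?thesis
    using assms(3) by (simp add: linear_maps_closed)
qed

lemma linear_maps_comp:
  "f \<in> linear_maps R M N \<Longrightarrow> g \<in> linear_maps R N Q \<Longrightarrow> (\<lambda>x. g (f x)) \<in> linear_maps R M Q"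
  by (rule linear_mapsI) (simp_all add: linear_maps_simps)

lemma linear_maps_id: "id \<in> linear_maps R M M"
  by (rule linear_mapsI) auto

lemma module_cring: "module R M \<Longrightarrow> cring R"
  by (simp add: module_def)

lemma free_module_simps:
  "zero (free_module R B) = (\<lambda>b. \<zero>\<^bsub>R\<^esub>)"
  "c \<oplus>\<^bsub>free_module R B\<^esub> d = (\<lambda>b. c b \<oplus>\<^bsub>R\<^esub> d b)"
  "r \<odot>\<^bsub>free_module R B\<^esub> c = (\<lambda>b. r \<otimes>\<^bsub>R\<^esub> c b)"
  by (simp_all add: free_module_def)

lemma free_module_carrier:
  "c \<in> carrier (free_module R B) \<longleftrightarrow>
    (\<forall>b\<in>B. c b \<in> carrier R) \<and> (\<forall>b. b \<notin> B \<longrightarrow> c b = \<zero>\<^bsub>R\<^esub>) \<and> finite {b. c b \<noteq> \<zero>\<^bsub>R\<^esub>}"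
  by (simp add: free_module_def)

lemma free_module_coeff:
  assumes "cring R" "c \<in> carrier (free_module R B)"
  shows "c b \<in> carrier R"
proof -
  interpret cring R by fact
  show ?thesis using assms(2) by (cases "b \<in> B") (auto simp: free_module_carrier)
qed

lemma free_module_module:
  assumes "cring R"
  shows "module R (free_module R B)"
proof -
  interpret cring R by fact
  let ?F = "free_module R B"
  note co [simp] = free_module_coeff[OF assms]
  have add: "c \<oplus>\<^bsub>?F\<^esub> d \<in> carrier ?F" if "c \<in> carrier ?F" "d \<in> carrier ?F" for c d
  proof -
    have "finite ({b. c b \<noteq> \<zero>\<^bsub>R\<^esub>} \<union> {b. d b \<noteq> \<zero>\<^bsub>R\<^esub>})"
      using that by (simp add: free_module_carrier)
    then have "finite {b. c b \<oplus>\<^bsub>R\<^esub> d b \<noteq> \<zero>\<^bsub>R\<^esub>}"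
      by (rule rev_finite_subset) auto
    then show ?thesis using that by (simp add: free_module_carrier free_module_simps)
  qed
  have smult: "r \<odot>\<^bsub>?F\<^esub> c \<in> carrier ?F" if "r \<in> carrier R" "c \<in> carrier ?F" for r c
  proof -
    have "finite {b. c b \<noteq> \<zero>\<^bsub>R\<^esub>}"
      using that by (simp add: free_module_carrier)
    then have "finite {b. r \<otimes>\<^bsub>R\<^esub> c b \<noteq> \<zero>\<^bsub>R\<^esub>}"
      by (rule rev_finite_subset) (use that in auto)
    then show ?thesis using that by (simp add: free_module_carrier free_module_simps)
  qed
  have minus: "\<exists>d\<in>carrier ?F. d \<oplus>\<^bsub>?F\<^esub> c = \<zero>\<^bsub>?F\<^esub>" if "c \<in> carrier ?F" for c
  proof
    show "(\<ominus>\<^bsub>R\<^esub> \<one>\<^bsub>R\<^esub>) \<odot>\<^bsub>?F\<^esub> c \<in> carrier ?F" by (rule smult) (use that in auto)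
    show "(\<ominus>\<^bsub>R\<^esub> \<one>\<^bsub>R\<^esub>) \<odot>\<^bsub>?F\<^esub> c \<oplus>\<^bsub>?F\<^esub> c = \<zero>\<^bsub>?F\<^esub>"
      using that by (simp add: free_module_simps l_minus l_neg)
  qed
  show ?thesis
  proof (rule moduleI)
    show "abelian_group ?F"
    proof (rule abelian_groupI)
      show "\<zero>\<^bsub>?F\<^esub> \<in> carrier ?F" by (simp add: free_module_carrier free_module_simps)
    qed (use add minus in \<open>auto simp: free_module_simps a_ac\<close>)
  qed (use smult assms in \<open>auto simp: free_module_simps l_distr r_distr m_assoc\<close>)
qed

lemma basis_elem_closed:
  assumes "cring R" "b \<in> B"
  shows "basis_elem R b \<in> carrier (free_module R B)"
proof -
  interpret cring R by fact
  have "finite {b'. basis_elem R b b' \<noteq> \<zero>\<^bsub>R\<^esub>}"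
    by (rule finite_subset[of _ "{b}"]) (auto simp: basis_elem_def)
  then show ?thesis using assms(2) by (auto simp: free_module_carrier basis_elem_def)
qed

text \<open>Induction over the finite support: setting one coefficient to zero removes exactly that
  point from the support, and the removed part is a scalar multiple of a basis element.\<close>

lemma free_module_induct [consumes 2, case_names zero basis add]:
  assumes "cring R" "c \<in> carrier (free_module R B)"
    and zero: "P \<zero>\<^bsub>free_module R B\<^esub>"
    and basis: "\<And>r b. r \<in> carrier R \<Longrightarrow> b \<in> B \<Longrightarrow> P (r \<odot>\<^bsub>free_module R B\<^esub> basis_elem R b)"
    and add: "\<And>c d. c \<in> carrier (free_module R B) \<Longrightarrow> d \<in> carrier (free_module R B) \<Longrightarrow>
      P c \<Longrightarrow> P d \<Longrightarrow> P (c \<oplus>\<^bsub>free_module R B\<^esub> d)"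
  shows "P c"
proof -
  interpret cring R by fact
  let ?F = "free_module R B"
  interpret F: module R ?F by (rule free_module_module) fact
  have "P c" if "finite S" "{b. c b \<noteq> \<zero>\<^bsub>R\<^esub>} = S" "c \<in> carrier ?F" for S c
    using that
  proof (induction S arbitrary: c rule: finite_induct)
    case empty
    then have "c = \<zero>\<^bsub>?F\<^esub>" by (auto simp: fun_eq_iff free_module_simps)
    with zero show ?case by simp
  next
    case (insert b S)
    have co: "c x \<in> carrier R" for x
      using insert.prems assms(1) by (simp add: free_module_coeff)
    have cb: "c b \<noteq> \<zero>\<^bsub>R\<^esub>" using insert.prems by auto
    then have bB: "b \<in> B" using insert.prems by (auto simp: free_module_carrier)
    have S: "{x. (c(b := \<zero>\<^bsub>R\<^esub>)) x \<noteq> \<zero>\<^bsub>R\<^esub>} = S"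
      using insert by auto
    have c0: "c(b := \<zero>\<^bsub>R\<^esub>) \<in> carrier ?F"
      using insert.prems S insert.hyps by (auto simp: free_module_carrier)
    have "c = c(b := \<zero>\<^bsub>R\<^esub>) \<oplus>\<^bsub>?F\<^esub> c b \<odot>\<^bsub>?F\<^esub> basis_elem R b"
      using co by (auto simp: fun_eq_iff basis_elem_def free_module_simps)
    moreover have "P (c(b := \<zero>\<^bsub>R\<^esub>) \<oplus>\<^bsub>?F\<^esub> c b \<odot>\<^bsub>?F\<^esub> basis_elem R b)"
      using insert.IH[OF S c0] c0 co bB by (intro add basis F.smult_closed basis_elem_closed assms(1))
    ultimately show ?case by simp
  qed
  then show ?thesis using assms(2) by (auto simp: free_module_carrier)
qed

lemma linear_maps_free_eqI:
  assumes "module R N"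
    and f: "f \<in> linear_maps R (free_module R B) N" and g: "g \<in> linear_maps R (free_module R B) N"
    and eq: "\<And>b. b \<in> B \<Longrightarrow> f (basis_elem R b) = g (basis_elem R b)"
    and c: "c \<in> carrier (free_module R B)"
  shows "f c = g c"
proof -
  note R = module_cring[OF assms(1)]
  show ?thesis
    using R c
  proof (induction rule: free_module_induct)
    case zero
    show ?case
      using linear_maps_zero[OF free_module_module[OF R] assms(1)] f g by metis
  next
    case (basis r b)
    then show ?case
      using f g eq by (simp add: linear_maps_smult basis_elem_closed R)
  next
    case (add c d)
    then show ?case
      using f g by (simp add: linear_maps_add)
  qed
qed

text \<open>The defining sum of \<open>lin_ext\<close> runs over the support, which can shrink by
  cancellation under addition and scaling. Linearity is therefore proved over a common finite index
  set, on which the additional terms vanish.\<close>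

lemma lin_ext_superset:
  assumes "module R N" "c \<in> carrier (free_module R B)" "\<phi> \<in> B \<rightarrow> carrier N"
    and "finite S" "{b. c b \<noteq> \<zero>\<^bsub>R\<^esub>} \<subseteq> S" "S \<subseteq> B"
  shows "lin_ext R N \<phi> c = (\<Oplus>\<^bsub>N\<^esub>b\<in>S. c b \<odot>\<^bsub>N\<^esub> \<phi> b)"
proof -
  interpret N: module R N by fact
  show ?thesis
    unfolding lin_ext_def
    by (rule N.add.finprod_mono_neutral_cong_left)
      (use assms in \<open>auto simp: free_module_carrier Pi_iff subset_iff\<close>)
qed

lemma lin_ext_linear:
  assumes "module R N" "\<phi> \<in> B \<rightarrow> carrier N"
  shows "lin_ext R N \<phi> \<in> linear_maps R (free_module R B) N"
proof -
  interpret N: module R N by fact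
  let ?F = "free_module R B"
  note R = N.R.is_cring
  interpret F: module R ?F by (rule free_module_module) (rule R)
  note co = free_module_coeff[OF R]
  have sub: "{b. c b \<noteq> \<zero>\<^bsub>R\<^esub>} \<subseteq> B" "finite {b. c b \<noteq> \<zero>\<^bsub>R\<^esub>}" if "c \<in> carrier ?F" for c
    using that by (auto simp: free_module_carrier)
  show ?thesis
  proof (rule linear_mapsI)
    fix c assume c: "c \<in> carrier ?F"
    show "lin_ext R N \<phi> c \<in> carrier N"
      unfolding lin_ext_def by (rule N.finsum_closed) (use sub(1)[OF c] co[OF c] assms(2) in auto)
  next
    fix c d assume cd: "c \<in> carrier ?F" "d \<in> carrier ?F"
    define S where "S = {b. c b \<noteq> \<zero>\<^bsub>R\<^esub>} \<union> {b. d b \<noteq> \<zero>\<^bsub>R\<^esub>}"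
    have S: "finite S" "S \<subseteq> B" using sub[OF cd(1)] sub[OF cd(2)] by (auto simp: S_def)
    have R_cd: "c b \<in> carrier R" "d b \<in> carrier R" for b
      using co[OF cd(1)] co[OF cd(2)] .
    have N_\<phi>: "\<phi> b \<in> carrier N" if "b \<in> S" for b
      using that S(2) assms(2) by auto
    have "lin_ext R N \<phi> (c \<oplus>\<^bsub>?F\<^esub> d) = (\<Oplus>\<^bsub>N\<^esub>b\<in>S. (c \<oplus>\<^bsub>?F\<^esub> d) b \<odot>\<^bsub>N\<^esub> \<phi> b)"
      by (rule lin_ext_superset[OF assms(1) F.a_closed[OF cd] assms(2) S(1) _ S(2)])
        (auto simp: S_def free_module_simps)
    also have "\<dots> = (\<Oplus>\<^bsub>N\<^esub>b\<in>S. c b \<odot>\<^bsub>N\<^esub> \<phi> b \<oplus>\<^bsub>N\<^esub> d b \<odot>\<^bsub>N\<^esub> \<phi> b)"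
      by (rule N.finsum_cong') (simp_all add: free_module_simps N.smult_l_distr R_cd N_\<phi>)
    also have "\<dots> = (\<Oplus>\<^bsub>N\<^esub>b\<in>S. c b \<odot>\<^bsub>N\<^esub> \<phi> b) \<oplus>\<^bsub>N\<^esub> (\<Oplus>\<^bsub>N\<^esub>b\<in>S. d b \<odot>\<^bsub>N\<^esub> \<phi> b)"
      by (rule N.finsum_addf) (simp_all add: R_cd N_\<phi>)
    also have "\<dots> = lin_ext R N \<phi> c \<oplus>\<^bsub>N\<^esub> lin_ext R N \<phi> d"
    proof -
      have sup: "{b. c b \<noteq> \<zero>\<^bsub>R\<^esub>} \<subseteq> S" "{b. d b \<noteq> \<zero>\<^bsub>R\<^esub>} \<subseteq> S" by (auto simp: S_def)
      show ?thesis
        unfolding lin_ext_superset[OF assms(1) cd(1) assms(2) S(1) sup(1) S(2)]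
          lin_ext_superset[OF assms(1) cd(2) assms(2) S(1) sup(2) S(2)] ..
    qed
    finally show "lin_ext R N \<phi> (c \<oplus>\<^bsub>?F\<^esub> d) = lin_ext R N \<phi> c \<oplus>\<^bsub>N\<^esub> lin_ext R N \<phi> d" .
  next
    fix r c assume rc: "r \<in> carrier R" "c \<in> carrier ?F"
    define S where "S = {b. c b \<noteq> \<zero>\<^bsub>R\<^esub>}"
    have S: "finite S" "S \<subseteq> B" using sub[OF rc(2)] by (auto simp: S_def)
    have R_c: "c b \<in> carrier R" for b
      using co[OF rc(2)] .
    have N_\<phi>: "\<phi> b \<in> carrier N" if "b \<in> S" for b
      using that S(2) assms(2) by auto
    have "lin_ext R N \<phi> (r \<odot>\<^bsub>?F\<^esub> c) = (\<Oplus>\<^bsub>N\<^esub>b\<in>S. (r \<odot>\<^bsub>?F\<^esub> c) b \<odot>\<^bsub>N\<^esub> \<phi> b)"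
      by (rule lin_ext_superset[OF assms(1) F.smult_closed[OF rc] assms(2) S(1) _ S(2)])
        (use rc in \<open>auto simp: S_def free_module_simps\<close>)
    also have "\<dots> = (\<Oplus>\<^bsub>N\<^esub>b\<in>S. r \<odot>\<^bsub>N\<^esub> (c b \<odot>\<^bsub>N\<^esub> \<phi> b))"
      by (rule N.finsum_cong') (simp_all add: free_module_simps N.smult_assoc1 rc R_c N_\<phi>)
    also have "\<dots> = r \<odot>\<^bsub>N\<^esub> (\<Oplus>\<^bsub>N\<^esub>b\<in>S. c b \<odot>\<^bsub>N\<^esub> \<phi> b)"
      by (rule N.finsum_smult_ldistr[symmetric]) (simp_all add: rc S R_c N_\<phi>)
    also have "\<dots> = r \<odot>\<^bsub>N\<^esub> lin_ext R N \<phi> c"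
      by (simp add: S_def lin_ext_def)
    finally show "lin_ext R N \<phi> (r \<odot>\<^bsub>?F\<^esub> c) = r \<odot>\<^bsub>N\<^esub> lin_ext R N \<phi> c" .
  qed
qed

lemma lin_ext_basis_elem:
  assumes "module R N" "\<phi> b \<in> carrier N"
  shows "lin_ext R N \<phi> (basis_elem R b) = \<phi> b"
proof -
  interpret N: module R N by fact
  \<comment> \<open>Over the zero ring a basis element has empty support, so \<open>{b}\<close>
    serves only as a superset of it.\<close>
  have "lin_ext R N \<phi> (basis_elem R b) = (\<Oplus>\<^bsub>N\<^esub>x\<in>{b}. basis_elem R b x \<odot>\<^bsub>N\<^esub> \<phi> x)"
    by (rule lin_ext_superset[where B = "{b}"])
      (use assms basis_elem_closed[OF N.R.is_cring, of b "{b}"] in \<open>auto simp: basis_elem_def\<close>)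
  also have "\<dots> = \<phi> b"
    using assms(2) by (simp add: basis_elem_def)
  finally show ?thesis .
qed

section \<open>Tensor products\<close>

lemma submodule_Inter:
  assumes "module R M" "\<And>K. K \<in> \<K> \<Longrightarrow> submodule K R M" "\<K> \<noteq> {}"
  shows "submodule (\<Inter>\<K>) R M"
proof -
  interpret M: module R M by fact
  note E = M.submoduleE[OF assms(2)]
  show ?thesis
  proof (rule M.submoduleI)
    obtain K where "K \<in> \<K>" using assms(3) by auto
    then show "\<Inter>\<K> \<subseteq> carrier M" using E(1)[of K] by auto
    show "\<zero>\<^bsub>M\<^esub> \<in> \<Inter>\<K>"
      using subgroup.one_closed[OF submodule.axioms(1)[OF assms(2)]] by auto
  qed (auto intro: E(3-5))
qed

lemma tensor_gens_subset:
  assumes "module R M" "module R N"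
  shows "tensor_gens R M N \<subseteq> carrier (tensor_free R M N)"
proof -
  interpret M: module R M by fact
  interpret N: module R N by fact
  interpret F: module R "tensor_free R M N" by (rule free_module_module) (rule M.R.is_cring)
  note basis [simp] = basis_elem_closed[OF M.R.is_cring, of _ "carrier M \<times> carrier N"]
  show ?thesis
  proof
    fix t assume "t \<in> tensor_gens R M N"
    then show "t \<in> carrier (tensor_free R M N)"
      by cases simp_all
  qed
qed

text \<open>The whole free module is a submodule containing the generators, so the intersection
  defining the relations is over a nonempty family.\<close>

lemma tensor_rel_submodule:
  assumes "module R M" "module R N"
  shows "submodule (tensor_rel R M N) R (tensor_free R M N)"
proof -
  have F: "module R (tensor_free R M N)"
    using module_cring[OF assms(1)] by (rule free_module_module)
  show ?thesis
    unfolding tensor_rel_def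
    using tensor_gens_subset[OF assms] module.carrier_is_submodule[OF F]
    by (intro submodule_Inter[OF F]) auto
qed

lemma tensor_gens_rel: "t \<in> tensor_gens R M N \<Longrightarrow> t \<in> tensor_rel R M N"
  by (auto simp: tensor_rel_def)

section \<open>The quotient by the bilinearity relations as a module\<close>

locale two_modules = M: module R M + N: module R N
  for R :: "('r, 'q) ring_scheme" and M :: "('r, 'm, 'e) module_scheme"
    and N :: "('r, 'n, 'f) module_scheme"
begin

abbreviation "F \<equiv> tensor_free R M N"
abbreviation "K \<equiv> tensor_rel R M N"
abbreviation "T \<equiv> tensor_prod R M N"
abbreviation cls where "cls c \<equiv> K +>\<^bsub>F\<^esub> c"

lemma modM: "module R M" and modN: "module R N"
  by (rule M.module_axioms N.module_axioms)+

sublocale F: module R F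
  by (rule free_module_module) (rule M.R.is_cring)

sublocale K: abelian_subgroup K F
  using submodule.axioms(1)[OF tensor_rel_submodule[OF modM modN]] F.a_comm_group
  by (intro abelian_subgroupI2)

lemma tensor_prod_carrier: "carrier T = cls ` carrier F"
  by (auto simp: tensor_prod_def A_RCOSETS_def RCOSETS_def a_r_coset_def)

lemma tensor_prod_zero: "\<zero>\<^bsub>T\<^esub> = K"
  by (simp add: tensor_prod_def)

lemma cls_add: "c \<in> carrier F \<Longrightarrow> d \<in> carrier F \<Longrightarrow> cls c \<oplus>\<^bsub>T\<^esub> cls d = cls (c \<oplus>\<^bsub>F\<^esub> d)"
  by (simp add: tensor_prod_def K.a_rcos_sum)

lemma cls_eqI:
  assumes "c \<in> carrier F" "d \<in> carrier F" "c \<ominus>\<^bsub>F\<^esub> d \<in> K"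
  shows "cls c = cls d"
proof -
  have "c \<in> cls d"
    using assms K.a_rcos_module_rev[of d c] by (simp add: a_minus_def)
  then show ?thesis
    using F.a_repr_independence[OF _ assms(2) K.a_subgroup] by simp
qed

lemma cls_eqD:
  assumes "c \<in> carrier F" "d \<in> cls c"
  shows "d \<in> carrier F \<and> d \<ominus>\<^bsub>F\<^esub> c \<in> K"
  using K.a_rcos_module_imp[OF assms] F.a_r_coset_subset_G[OF K.a_subset assms(1)] assms(2)
  by (auto simp: a_minus_def)

text \<open>Scaling a coset is defined as a union over all its representatives. The relations are
  closed under scalars, so every representative contributes the same coset and the union
  collapses.\<close>

lemma cls_smult:
  assumes "r \<in> carrier R" "c \<in> carrier F"
  shows "r \<odot>\<^bsub>T\<^esub> cls c = cls (r \<odot>\<^bsub>F\<^esub> c)"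
proof -
  have "cls (r \<odot>\<^bsub>F\<^esub> d) = cls (r \<odot>\<^bsub>F\<^esub> c)" if "d \<in> cls c" for d
  proof (rule cls_eqI)
    note d = cls_eqD[OF assms(2) that]
    show "r \<odot>\<^bsub>F\<^esub> d \<in> carrier F" "r \<odot>\<^bsub>F\<^esub> c \<in> carrier F" using d assms by auto
    have "r \<odot>\<^bsub>F\<^esub> (d \<ominus>\<^bsub>F\<^esub> c) \<in> K"
      using d assms(1) submodule.smult_closed[OF tensor_rel_submodule[OF modM modN]] by simp
    then show "r \<odot>\<^bsub>F\<^esub> d \<ominus>\<^bsub>F\<^esub> r \<odot>\<^bsub>F\<^esub> c \<in> K"
      using d assms by (simp add: a_minus_def F.smult_r_distr F.smult_r_minus)
  qed
  moreover have "c \<in> cls c" using assms by (simp add: K.a_rcos_self)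
  ultimately have "(\<Union>d\<in>cls c. cls (r \<odot>\<^bsub>F\<^esub> d)) = cls (r \<odot>\<^bsub>F\<^esub> c)" by blast
  then show ?thesis by (simp add: tensor_prod_def)
qed

lemma tensor_prod_module: "module R T"
proof (rule moduleI)
  show "cring R" by (rule M.R.is_cring)
  have zero: "\<zero>\<^bsub>T\<^esub> = cls \<zero>\<^bsub>F\<^esub>"
    using K.a_rcos_const[OF K.zero_closed] by (simp add: tensor_prod_zero)
  show "abelian_group T"
  proof (rule abelian_groupI)
    fix s assume "s \<in> carrier T"
    then obtain c where c: "s = cls c" "c \<in> carrier F" by (auto simp: tensor_prod_carrier)
    then have "cls (\<ominus>\<^bsub>F\<^esub> c) \<oplus>\<^bsub>T\<^esub> s = \<zero>\<^bsub>T\<^esub>" by (simp add: cls_add zero F.l_neg)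
    then show "\<exists>t\<in>carrier T. t \<oplus>\<^bsub>T\<^esub> s = \<zero>\<^bsub>T\<^esub>"
      using c by (auto simp: tensor_prod_carrier)
  qed (auto simp: tensor_prod_carrier cls_add zero F.a_ac)
qed (auto simp: tensor_prod_carrier cls_add cls_smult F.smult_l_distr F.smult_r_distr F.smult_assoc1)

sublocale T: module R T
  by (rule tensor_prod_module)

abbreviation pure where "pure \<equiv> pure_tensor R M N"

lemma basis_F: "x \<in> carrier M \<Longrightarrow> y \<in> carrier N \<Longrightarrow> basis_elem R (x, y) \<in> carrier F"
  by (simp add: basis_elem_closed M.R.is_cring)

lemma pure_closed: "x \<in> carrier M \<Longrightarrow> y \<in> carrier N \<Longrightarrow> pure x y \<in> carrier T"
  by (simp add: pure_tensor_def tensor_prod_carrier basis_F)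

lemma pure_add_left:
  "x \<in> carrier M \<Longrightarrow> x' \<in> carrier M \<Longrightarrow> y \<in> carrier N \<Longrightarrow>
    pure (x \<oplus>\<^bsub>M\<^esub> x') y = pure x y \<oplus>\<^bsub>T\<^esub> pure x' y"
  unfolding pure_tensor_def
  by (subst cls_add) (simp_all add: basis_F cls_eqI tensor_gens_rel tensor_gens.add_left)

lemma pure_add_right:
  "x \<in> carrier M \<Longrightarrow> y \<in> carrier N \<Longrightarrow> y' \<in> carrier N \<Longrightarrow>
    pure x (y \<oplus>\<^bsub>N\<^esub> y') = pure x y \<oplus>\<^bsub>T\<^esub> pure x y'"
  unfolding pure_tensor_def
  by (subst cls_add) (simp_all add: basis_F cls_eqI tensor_gens_rel tensor_gens.add_right)

lemma pure_smult_left: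
  "r \<in> carrier R \<Longrightarrow> x \<in> carrier M \<Longrightarrow> y \<in> carrier N \<Longrightarrow> pure (r \<odot>\<^bsub>M\<^esub> x) y = r \<odot>\<^bsub>T\<^esub> pure x y"
  unfolding pure_tensor_def
  by (subst cls_smult) (simp_all add: basis_F cls_eqI tensor_gens_rel tensor_gens.smult_left)

lemma pure_smult_right:
  "r \<in> carrier R \<Longrightarrow> x \<in> carrier M \<Longrightarrow> y \<in> carrier N \<Longrightarrow> pure x (r \<odot>\<^bsub>N\<^esub> y) = r \<odot>\<^bsub>T\<^esub> pure x y"
  unfolding pure_tensor_def
  by (subst cls_smult) (simp_all add: basis_F cls_eqI tensor_gens_rel tensor_gens.smult_right)

lemma pure_zero_left: "y \<in> carrier N \<Longrightarrow> pure \<zero>\<^bsub>M\<^esub> y = \<zero>\<^bsub>T\<^esub>"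
  using pure_smult_left[of "\<zero>\<^bsub>R\<^esub>" "\<zero>\<^bsub>M\<^esub>" y] by (simp add: pure_closed)

lemma pure_zero_right: "x \<in> carrier M \<Longrightarrow> pure x \<zero>\<^bsub>N\<^esub> = \<zero>\<^bsub>T\<^esub>"
  using pure_smult_right[of "\<zero>\<^bsub>R\<^esub>" x "\<zero>\<^bsub>N\<^esub>"] by (simp add: pure_closed)

text \<open>Scalars can be absorbed into the left factor, so pure tensors generate the tensor product additively.\<close>

lemma tensor_induct [consumes 1, case_names pure add]:
  assumes "t \<in> carrier T"
    and pure: "\<And>x y. x \<in> carrier M \<Longrightarrow> y \<in> carrier N \<Longrightarrow> P (pure x y)"
    and add: "\<And>s t. s \<in> carrier T \<Longrightarrow> t \<in> carrier T \<Longrightarrow> P s \<Longrightarrow> P t \<Longrightarrow> P (s \<oplus>\<^bsub>T\<^esub> t)"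
  shows "P t"
proof -
  have "P (cls c)" if "c \<in> carrier F" for c
    using M.R.is_cring that
  proof (induction rule: free_module_induct)
    case zero
    \<comment> \<open>Zero is the pure tensor of two zeros, so the induction rule can do without a
      case for it.\<close>
    have "cls \<zero>\<^bsub>F\<^esub> = pure \<zero>\<^bsub>M\<^esub> \<zero>\<^bsub>N\<^esub>"
      using K.a_rcos_const[OF K.zero_closed] by (simp add: pure_zero_left tensor_prod_zero)
    then show ?case using pure by simp
  next
    case (basis r b)
    then obtain x y where b: "b = (x, y)" "x \<in> carrier M" "y \<in> carrier N" by auto
    have "cls (r \<odot>\<^bsub>F\<^esub> basis_elem R b) = pure (r \<odot>\<^bsub>M\<^esub> x) y"
      unfolding pure_smult_left[OF basis(1) b(2,3)] unfolding b(1) pure_tensor_def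
      using basis b by (simp add: cls_smult basis_F)
    then show ?case using pure basis b by simp
  next
    case (add c d)
    then have "P (cls c \<oplus>\<^bsub>T\<^esub> cls d)"
      by (intro assms(3)) (auto simp: tensor_prod_carrier)
    then show ?case using add by (simp add: cls_add)
  qed
  then show ?thesis using assms(1) by (auto simp: tensor_prod_carrier)
qed

end

section \<open>Bilinear maps and the universal property of the tensor product\<close>

definition bilinear_maps ::
  "('r, 'q) ring_scheme \<Rightarrow> ('r, 'm, 'e) module_scheme \<Rightarrow> ('r, 'n, 'f) module_scheme \<Rightarrow>
    ('r, 'p, 'g) module_scheme \<Rightarrow> ('m \<Rightarrow> 'n \<Rightarrow> 'p) set"
  where "bilinear_maps R M N Q =
    {\<beta>. (\<forall>x\<in>carrier M. \<beta> x \<in> linear_maps R N Q) \<and>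
        (\<forall>y\<in>carrier N. (\<lambda>x. \<beta> x y) \<in> linear_maps R M Q)}"

lemma bilinear_mapsI:
  assumes "\<And>x. x \<in> carrier M \<Longrightarrow> \<beta> x \<in> linear_maps R N Q"
    and "\<And>y. y \<in> carrier N \<Longrightarrow> (\<lambda>x. \<beta> x y) \<in> linear_maps R M Q"
  shows "\<beta> \<in> bilinear_maps R M N Q"
  using assms by (auto simp: bilinear_maps_def)

lemma bilinear_maps_linear:
  assumes "\<beta> \<in> bilinear_maps R M N Q"
  shows "x \<in> carrier M \<Longrightarrow> \<beta> x \<in> linear_maps R N Q"
    and "y \<in> carrier N \<Longrightarrow> (\<lambda>x. \<beta> x y) \<in> linear_maps R M Q"
  using assms by (auto simp: bilinear_maps_def)

lemma bilinear_maps_simps: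
  assumes "\<beta> \<in> bilinear_maps R M N Q" "x \<in> carrier M" "y \<in> carrier N"
  shows "\<beta> x y \<in> carrier Q"
    and "x' \<in> carrier M \<Longrightarrow> \<beta> (x \<oplus>\<^bsub>M\<^esub> x') y = \<beta> x y \<oplus>\<^bsub>Q\<^esub> \<beta> x' y"
    and "y' \<in> carrier N \<Longrightarrow> \<beta> x (y \<oplus>\<^bsub>N\<^esub> y') = \<beta> x y \<oplus>\<^bsub>Q\<^esub> \<beta> x y'"
    and "r \<in> carrier R \<Longrightarrow> \<beta> (r \<odot>\<^bsub>M\<^esub> x) y = r \<odot>\<^bsub>Q\<^esub> \<beta> x y"
    and "r \<in> carrier R \<Longrightarrow> \<beta> x (r \<odot>\<^bsub>N\<^esub> y) = r \<odot>\<^bsub>Q\<^esub> \<beta> x y"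
  using linear_maps_simps[OF bilinear_maps_linear(1)[OF assms(1,2)]]
    linear_maps_simps[OF bilinear_maps_linear(2)[OF assms(1,3)]] assms(2,3)
  by auto

context two_modules
begin

lemma pure_bilinear: "pure \<in> bilinear_maps R M N T"
  by (intro bilinear_mapsI linear_mapsI)
    (simp_all add: pure_closed pure_add_left pure_add_right pure_smult_left pure_smult_right)

text \<open>Bilinearity of \<open>\<beta>\<close> says exactly that its linear extension kills the
  generators of the relations. The kernel is a submodule, hence contains all relations, and so the
  value at the representative picked by \<open>SOME\<close> agrees with the value at any
  other.\<close>

lemma tensor_lift_cls:
  assumes Q: "module R Q" and \<beta>: "\<beta> \<in> bilinear_maps R M N Q" and c: "c \<in> carrier F"
  shows "tensor_lift R Q \<beta> (cls c) = lin_ext R Q (\<lambda>(x, y). \<beta> x y) c"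
proof -
  interpret Q: module R Q by fact
  let ?L = "lin_ext R Q (\<lambda>(x, y). \<beta> x y)"
  note [simp] = bilinear_maps_simps[OF \<beta>]
  have L: "?L \<in> linear_maps R F Q"
    by (rule lin_ext_linear[OF Q]) auto
  note Lsimps = linear_maps_simps[OF L]
  have L0: "?L \<zero>\<^bsub>F\<^esub> = \<zero>\<^bsub>Q\<^esub>"
    using linear_maps_zero[OF F.module_axioms Q L] .
  have Lminus: "?L (\<ominus>\<^bsub>F\<^esub> d) = \<ominus>\<^bsub>Q\<^esub> ?L d" if "d \<in> carrier F" for d
  proof -
    have "?L (\<ominus>\<^bsub>F\<^esub> d) \<oplus>\<^bsub>Q\<^esub> ?L d = \<zero>\<^bsub>Q\<^esub>"
      using that L0 Lsimps(2)[of "\<ominus>\<^bsub>F\<^esub> d" d] by (simp add: F.l_neg)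
    then show ?thesis using that Lsimps(1) by (intro Q.minus_equality[symmetric]) auto
  qed
  have Lbasis: "?L (basis_elem R (x, y)) = \<beta> x y" if "x \<in> carrier M" "y \<in> carrier N" for x y
    by (subst lin_ext_basis_elem[OF Q]) (use that in auto)
  define Ker where "Ker = {d \<in> carrier F. ?L d = \<zero>\<^bsub>Q\<^esub>}"
  have "submodule Ker R F"
    by (rule F.submoduleI) (auto simp: Ker_def L0 Lminus Lsimps)
  moreover have "tensor_gens R M N \<subseteq> Ker"
  proof
    fix t assume t: "t \<in> tensor_gens R M N"
    from t have "?L t = \<zero>\<^bsub>Q\<^esub>"
      by cases (simp_all add: a_minus_def Lsimps Lminus Lbasis basis_F Q.r_neg)
    then show "t \<in> Ker" using t tensor_gens_subset[OF modM modN] by (auto simp: Ker_def)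
  qed
  ultimately have K: "K \<subseteq> Ker" by (auto simp: tensor_rel_def)
  have "(SOME d. d \<in> cls c) \<in> cls c"
    using K.a_rcos_self[OF c] by (rule someI[of "\<lambda>d. d \<in> cls c"])
  then obtain d where d: "d = (SOME d. d \<in> cls c)" "d \<in> carrier F" "d \<ominus>\<^bsub>F\<^esub> c \<in> K"
    using cls_eqD[OF c] by blast
  have "?L (d \<ominus>\<^bsub>F\<^esub> c) = \<zero>\<^bsub>Q\<^esub>"
    using K d(3) by (auto simp: Ker_def)
  then have "?L d \<ominus>\<^bsub>Q\<^esub> ?L c = \<zero>\<^bsub>Q\<^esub>"
    using c d(2) by (simp add: a_minus_def Lsimps Lminus)
  then have "?L d = ?L c"
    using c d(2) Lsimps(1) Q.minus_equality[of "?L d" "\<ominus>\<^bsub>Q\<^esub> ?L c"] by (simp add: a_minus_def)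
  then show ?thesis by (simp add: tensor_lift_def d(1))
qed

lemma tensor_lift_linear:
  assumes Q: "module R Q" and \<beta>: "\<beta> \<in> bilinear_maps R M N Q"
  shows "tensor_lift R Q \<beta> \<in> linear_maps R T Q"
proof -
  let ?L = "lin_ext R Q (\<lambda>(x, y). \<beta> x y)"
  have L: "?L \<in> linear_maps R F Q"
    by (rule lin_ext_linear[OF Q]) (auto simp: bilinear_maps_simps[OF \<beta>])
  show ?thesis
    by (rule linear_mapsI)
      (auto simp: tensor_prod_carrier cls_add cls_smult tensor_lift_cls[OF Q \<beta>] linear_maps_simps[OF L])
qed

lemma tensor_lift_pure:
  assumes Q: "module R Q" and \<beta>: "\<beta> \<in> bilinear_maps R M N Q" and "x \<in> carrier M" "y \<in> carrier N"
  shows "tensor_lift R Q \<beta> (pure x y) = \<beta> x y"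
proof -
  have "tensor_lift R Q \<beta> (pure x y) = lin_ext R Q (\<lambda>(x, y). \<beta> x y) (basis_elem R (x, y))"
    unfolding pure_tensor_def using assms by (intro tensor_lift_cls) (simp_all add: basis_F)
  also have "\<dots> = \<beta> x y"
    by (subst lin_ext_basis_elem[OF Q]) (use assms in \<open>auto simp: bilinear_maps_simps\<close>)
  finally show ?thesis .
qed

end

section \<open>Maps of tensor products and the bimodule structure\<close>

text \<open>The facts from the locale are restated with the modules as explicit hypotheses, since
  iterated tensor products need them for several pairs of factors at once.\<close>

lemma module_tensor_prod:
  assumes "module R M" "module R N"
  shows "module R (tensor_prod R M N)"
proof -
  interpret two_modules R M N by (intro two_modules.intro assms)
  show ?thesis by (rule tensor_prod_module)
qed

lemma pure_tensor_simps:
  assumes "module R M" "module R N" "x \<in> carrier M" "y \<in> carrier N"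
  shows "pure_tensor R M N x y \<in> carrier (tensor_prod R M N)"
    and "x' \<in> carrier M \<Longrightarrow> pure_tensor R M N (x \<oplus>\<^bsub>M\<^esub> x') y =
      pure_tensor R M N x y \<oplus>\<^bsub>tensor_prod R M N\<^esub> pure_tensor R M N x' y"
    and "y' \<in> carrier N \<Longrightarrow> pure_tensor R M N x (y \<oplus>\<^bsub>N\<^esub> y') =
      pure_tensor R M N x y \<oplus>\<^bsub>tensor_prod R M N\<^esub> pure_tensor R M N x y'"
    and "r \<in> carrier R \<Longrightarrow> pure_tensor R M N (r \<odot>\<^bsub>M\<^esub> x) y =
      r \<odot>\<^bsub>tensor_prod R M N\<^esub> pure_tensor R M N x y"
    and "r \<in> carrier R \<Longrightarrow> pure_tensor R M N x (r \<odot>\<^bsub>N\<^esub> y) =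
      r \<odot>\<^bsub>tensor_prod R M N\<^esub> pure_tensor R M N x y"
proof -
  interpret two_modules R M N by (intro two_modules.intro assms)
  show "pure x y \<in> carrier T"
    and "x' \<in> carrier M \<Longrightarrow> pure (x \<oplus>\<^bsub>M\<^esub> x') y = pure x y \<oplus>\<^bsub>T\<^esub> pure x' y"
    and "y' \<in> carrier N \<Longrightarrow> pure x (y \<oplus>\<^bsub>N\<^esub> y') = pure x y \<oplus>\<^bsub>T\<^esub> pure x y'"
    and "r \<in> carrier R \<Longrightarrow> pure (r \<odot>\<^bsub>M\<^esub> x) y = r \<odot>\<^bsub>T\<^esub> pure x y"
    and "r \<in> carrier R \<Longrightarrow> pure x (r \<odot>\<^bsub>N\<^esub> y) = r \<odot>\<^bsub>T\<^esub> pure x y"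
    using assms(3,4) by (simp_all add: bilinear_maps_simps[OF pure_bilinear])
qed

lemma pure_tensor_zero:
  assumes "module R M" "module R N"
  shows "y \<in> carrier N \<Longrightarrow> pure_tensor R M N \<zero>\<^bsub>M\<^esub> y = \<zero>\<^bsub>tensor_prod R M N\<^esub>"
    and "x \<in> carrier M \<Longrightarrow> pure_tensor R M N x \<zero>\<^bsub>N\<^esub> = \<zero>\<^bsub>tensor_prod R M N\<^esub>"
proof -
  interpret two_modules R M N by (intro two_modules.intro assms)
  show "y \<in> carrier N \<Longrightarrow> pure \<zero>\<^bsub>M\<^esub> y = \<zero>\<^bsub>T\<^esub>" and "x \<in> carrier M \<Longrightarrow> pure x \<zero>\<^bsub>N\<^esub> = \<zero>\<^bsub>T\<^esub>"
    by (rule pure_zero_left pure_zero_right; assumption)+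
qed

lemma pure_linear:
  assumes "module R M" "module R N"
    and "f \<in> linear_maps R Q M" "y \<in> carrier N"
  shows "(\<lambda>x. pure_tensor R M N (f x) y) \<in> linear_maps R Q (tensor_prod R M N)"
  using assms(3,4) by (intro linear_mapsI) (simp_all add: linear_maps_simps pure_tensor_simps[OF assms(1,2)])

lemma pure_linear':
  assumes "module R M" "module R N"
    and "f \<in> linear_maps R Q N" "x \<in> carrier M"
  shows "(\<lambda>y. pure_tensor R M N x (f y)) \<in> linear_maps R Q (tensor_prod R M N)"
  using assms(3,4) by (intro linear_mapsI) (simp_all add: linear_maps_simps pure_tensor_simps[OF assms(1,2)])

lemma tensor_lift_linear':
  assumes "module R M" "module R N" "module R Q" "\<beta> \<in> bilinear_maps R M N Q"
  shows "tensor_lift R Q \<beta> \<in> linear_maps R (tensor_prod R M N) Q"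
proof -
  interpret two_modules R M N by (intro two_modules.intro assms)
  show ?thesis using assms by (intro tensor_lift_linear)
qed

lemma tensor_lift_pure':
  assumes "module R M" "module R N" "module R Q" "\<beta> \<in> bilinear_maps R M N Q"
    and "x \<in> carrier M" "y \<in> carrier N"
  shows "tensor_lift R Q \<beta> (pure_tensor R M N x y) = \<beta> x y"
proof -
  interpret two_modules R M N by (intro two_modules.intro assms)
  show ?thesis using assms by (intro tensor_lift_pure)
qed

lemma tensor_prod_induct [consumes 3, case_names pure add]:
  assumes "module R M" "module R N" "t \<in> carrier (tensor_prod R M N)"
    and "\<And>x y. x \<in> carrier M \<Longrightarrow> y \<in> carrier N \<Longrightarrow> P (pure_tensor R M N x y)"
    and "\<And>s t. s \<in> carrier (tensor_prod R M N) \<Longrightarrow> t \<in> carrier (tensor_prod R M N) \<Longrightarrow>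
      P s \<Longrightarrow> P t \<Longrightarrow> P (s \<oplus>\<^bsub>tensor_prod R M N\<^esub> t)"
  shows "P t"
proof -
  interpret two_modules R M N by (intro two_modules.intro assms)
  show ?thesis using assms(3-5) by (rule tensor_induct)
qed

lemma linear_maps_tensor_eqI:
  assumes "module R M" "module R N"
    and f: "f \<in> linear_maps R (tensor_prod R M N) Q" and g: "g \<in> linear_maps R (tensor_prod R M N) Q"
    and pure: "\<And>x y. x \<in> carrier M \<Longrightarrow> y \<in> carrier N \<Longrightarrow>
      f (pure_tensor R M N x y) = g (pure_tensor R M N x y)"
    and t: "t \<in> carrier (tensor_prod R M N)"
  shows "f t = g t"
  using assms(1,2) t
proof (induction rule: tensor_prod_induct)
  case (add s t)
  then show ?case by (simp add: linear_maps_add[OF f] linear_maps_add[OF g])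
qed (rule pure)

lemma linear_maps_sum:
  assumes "module R N" "f \<in> linear_maps R M N" "g \<in> linear_maps R M N"
  shows "(\<lambda>x. f x \<oplus>\<^bsub>N\<^esub> g x) \<in> linear_maps R M N"
proof -
  interpret N: module R N by fact
  show ?thesis
    using assms(2,3) by (intro linear_mapsI) (simp_all add: linear_maps_simps N.smult_r_distr N.a_ac)
qed

lemma linear_maps_scale:
  assumes "module R N" "f \<in> linear_maps R M N" "r \<in> carrier R"
  shows "(\<lambda>x. r \<odot>\<^bsub>N\<^esub> f x) \<in> linear_maps R M N"
proof -
  interpret N: module R N by fact
  show ?thesis
    using assms(2,3)
    by (intro linear_mapsI)
      (simp_all add: linear_maps_simps N.smult_r_distr N.smult_assoc1[symmetric] N.R.m_comm)
qed

lemma tensor_map_bilinear: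
  assumes "module R M'" "module R N'" "f \<in> linear_maps R M M'" "g \<in> linear_maps R N N'"
  shows "(\<lambda>x y. pure_tensor R M' N' (f x) (g y)) \<in> bilinear_maps R M N (tensor_prod R M' N')"
  using assms by (intro bilinear_mapsI pure_linear pure_linear') (simp_all add: linear_maps_closed)

lemma tensor_map_linear:
  assumes "module R M" "module R N" "module R M'" "module R N'"
    and "f \<in> linear_maps R M M'" "g \<in> linear_maps R N N'"
  shows "tensor_map R M' N' f g \<in> linear_maps R (tensor_prod R M N) (tensor_prod R M' N')"
  unfolding tensor_map_def
  using assms by (intro tensor_lift_linear' tensor_map_bilinear module_tensor_prod)

lemma tensor_map_pure:
  assumes "module R M" "module R N" "module R M'" "module R N'"
    and "f \<in> linear_maps R M M'" "g \<in> linear_maps R N N'" "x \<in> carrier M" "y \<in> carrier N"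
  shows "tensor_map R M' N' f g (pure_tensor R M N x y) = pure_tensor R M' N' (f x) (g y)"
  unfolding tensor_map_def
  using assms by (intro tensor_lift_pure' tensor_map_bilinear module_tensor_prod)

lemma tensor_map_comp:
  assumes "module R M" "module R N" "module R M'" "module R N'" "module R M''" "module R N''"
    and f: "f \<in> linear_maps R M M'" and g: "g \<in> linear_maps R N N'"
    and f': "f' \<in> linear_maps R M' M''" and g': "g' \<in> linear_maps R N' N''"
    and t: "t \<in> carrier (tensor_prod R M N)"
  shows "tensor_map R M'' N'' f' g' (tensor_map R M' N' f g t) =
    tensor_map R M'' N'' (\<lambda>x. f' (f x)) (\<lambda>x. g' (g x)) t"
proof (rule linear_maps_tensor_eqI[OF assms(1,2) _ _ _ t])
  show "(\<lambda>t. tensor_map R M'' N'' f' g' (tensor_map R M' N' f g t)) \<in>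
      linear_maps R (tensor_prod R M N) (tensor_prod R M'' N'')"
    by (rule linear_maps_comp[OF tensor_map_linear[OF assms(1-4) f g] tensor_map_linear[OF assms(3-6) f' g']])
  show "tensor_map R M'' N'' (\<lambda>x. f' (f x)) (\<lambda>x. g' (g x)) \<in>
      linear_maps R (tensor_prod R M N) (tensor_prod R M'' N'')"
    by (rule tensor_map_linear[OF assms(1,2,5,6) linear_maps_comp[OF f f'] linear_maps_comp[OF g g']])
next
  fix x y assume "x \<in> carrier M" "y \<in> carrier N"
  then show "tensor_map R M'' N'' f' g' (tensor_map R M' N' f g (pure_tensor R M N x y)) =
      tensor_map R M'' N'' (\<lambda>x. f' (f x)) (\<lambda>x. g' (g x)) (pure_tensor R M N x y)"
    by (simp add: tensor_map_pure[OF assms(1-4) f g] tensor_map_pure[OF assms(3-6) f' g']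
        linear_maps_closed[OF f] linear_maps_closed[OF g]
        tensor_map_pure[OF assms(1,2,5,6) linear_maps_comp[OF f f'] linear_maps_comp[OF g g']])
qed

lemma linear_maps_cong:
  assumes "f \<in> linear_maps R M N" "\<And>x. x \<in> carrier M \<Longrightarrow> f x = g x" "module R M"
  shows "g \<in> linear_maps R M N"
proof -
  interpret M: module R M by fact
  show ?thesis
    using assms(1) by (intro linear_mapsI) (simp_all add: linear_maps_simps flip: assms(2))
qed

lemma tensor_map_cong:
  assumes "module R M" "module R N" "module R M'" "module R N'"
    and f: "f \<in> linear_maps R M M'" and g: "g \<in> linear_maps R N N'"
    and eq: "\<And>x. x \<in> carrier M \<Longrightarrow> f x = f' x" "\<And>y. y \<in> carrier N \<Longrightarrow> g y = g' y"
    and t: "t \<in> carrier (tensor_prod R M N)"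
  shows "tensor_map R M' N' f g t = tensor_map R M' N' f' g' t"
proof -
  have f': "f' \<in> linear_maps R M M'" and g': "g' \<in> linear_maps R N N'"
    using f g eq assms(1,2) by (auto intro: linear_maps_cong)
  show ?thesis
    by (rule linear_maps_tensor_eqI[OF assms(1,2)
          tensor_map_linear[OF assms(1-4) f g] tensor_map_linear[OF assms(1-4) f' g'] _ t])
      (simp add: tensor_map_pure[OF assms(1-4) f g] tensor_map_pure[OF assms(1-4) f' g'] eq)
qed

section \<open>The two actions of an algebra on its tensor square\<close>

context unitary_algebra
begin

abbreviation "T \<equiv> tensor_prod R A A"
abbreviation "T\<^sub>3 \<equiv> tensor_prod R A T"
abbreviation "pure \<equiv> pure_tensor R A A"
abbreviation "pure\<^sub>3 \<equiv> pure_tensor R A T"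

lemma modA: "module R A" ..

lemma modT: "module R T"
  by (intro module_tensor_prod modA)

lemma modT3: "module R T\<^sub>3" and modT3': "module R (tensor_prod R T A)"
  by (intro module_tensor_prod modT modA)+

sublocale T: module R T by (rule modT)
sublocale T\<^sub>3: module R T\<^sub>3 by (rule modT3)

lemmas mods = modA modT modT3 modT3'

lemmas pure_simps = pure_tensor_simps[OF modA modA]
lemmas pure3_simps = pure_tensor_simps[OF modA modT]
lemmas pure3'_simps = pure_tensor_simps[OF modT modA]
lemmas pure3_zero = pure_tensor_zero[OF modA modT]
lemmas pure3'_zero = pure_tensor_zero[OF modT modA]
lemmas T_induct = tensor_prod_induct[OF modA modA, consumes 1, case_names pure add]
lemmas T_eqI = linear_maps_tensor_eqI[OF modA modA]

lemma mult_left_linear: "a \<in> carrier A \<Longrightarrow> (\<lambda>b. a \<otimes>\<^bsub>A\<^esub> b) \<in> linear_maps R A A"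
  by (intro linear_mapsI) (simp_all add: r_distr smult_mult_right)

lemma mult_right_linear: "a \<in> carrier A \<Longrightarrow> (\<lambda>b. b \<otimes>\<^bsub>A\<^esub> a) \<in> linear_maps R A A"
  by (intro linear_mapsI) (simp_all add: l_distr smult_mult_left)

text \<open>Each action is the tensor product of a multiplication map with the identity, so
  linearity in the tensor and the values on pure tensors are inherited from
  \<open>tensor_map\<close>.\<close>

lemma left_act_tensor_map: "left_act R A a = tensor_map R A A (\<lambda>b. a \<otimes>\<^bsub>A\<^esub> b) id"
  by (simp add: left_act_def tensor_map_def)

lemma right_act_tensor_map: "right_act R A t a = tensor_map R A A id (\<lambda>b. b \<otimes>\<^bsub>A\<^esub> a) t"
  by (simp add: right_act_def tensor_map_def)

lemma left_act_linear: "a \<in> carrier A \<Longrightarrow> left_act R A a \<in> linear_maps R T T"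
  unfolding left_act_tensor_map
  by (intro tensor_map_linear modA linear_maps_id mult_left_linear)

lemma right_act_linear: "a \<in> carrier A \<Longrightarrow> (\<lambda>t. right_act R A t a) \<in> linear_maps R T T"
  unfolding right_act_tensor_map
  by (intro tensor_map_linear modA linear_maps_id mult_right_linear)

lemma left_act_pure:
  "a \<in> carrier A \<Longrightarrow> x \<in> carrier A \<Longrightarrow> y \<in> carrier A \<Longrightarrow> left_act R A a (pure x y) = pure (a \<otimes>\<^bsub>A\<^esub> x) y"
  by (simp add: left_act_tensor_map tensor_map_pure modA linear_maps_id mult_left_linear)

lemma right_act_pure:
  "a \<in> carrier A \<Longrightarrow> x \<in> carrier A \<Longrightarrow> y \<in> carrier A \<Longrightarrow> right_act R A (pure x y) a = pure x (y \<otimes>\<^bsub>A\<^esub> a)"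
  by (simp add: right_act_tensor_map tensor_map_pure modA linear_maps_id mult_right_linear)

text \<open>Linearity in the acting element does not come from \<open>tensor_map\<close>. For fixed
  acting elements both sides of each identity are linear in \<open>t\<close>, and on pure tensors
  they agree by distributivity. This is what later allows induction on the acting element.\<close>

lemma left_act_bilinear: "left_act R A \<in> bilinear_maps R A T T"
proof (rule bilinear_mapsI)
  fix t assume t: "t \<in> carrier T"
  show "(\<lambda>a. left_act R A a t) \<in> linear_maps R A T"
  proof (rule linear_mapsI)
    fix a b assume ab: "a \<in> carrier A" "b \<in> carrier A"
    then show "left_act R A (a \<oplus>\<^bsub>A\<^esub> b) t = left_act R A a t \<oplus>\<^bsub>T\<^esub> left_act R A b t"
      by (intro T_eqI[OF left_act_linear linear_maps_sum[OF modT left_act_linear left_act_linear] _ t])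
        (simp_all add: left_act_pure pure_simps l_distr)
  next
    fix r a assume ra: "r \<in> carrier R" "a \<in> carrier A"
    then show "left_act R A (r \<odot>\<^bsub>A\<^esub> a) t = r \<odot>\<^bsub>T\<^esub> left_act R A a t"
      by (intro T_eqI[OF left_act_linear linear_maps_scale[OF modT left_act_linear] _ t])
        (simp_all add: left_act_pure pure_simps smult_mult_left)
  qed (simp add: t linear_maps_closed[OF left_act_linear])
qed (rule left_act_linear)

lemma right_act_bilinear: "right_act R A \<in> bilinear_maps R T A T"
proof (rule bilinear_mapsI)
  fix t assume t: "t \<in> carrier T"
  show "right_act R A t \<in> linear_maps R A T"
  proof (rule linear_mapsI)
    fix a b assume ab: "a \<in> carrier A" "b \<in> carrier A"
    then show "right_act R A t (a \<oplus>\<^bsub>A\<^esub> b) = right_act R A t a \<oplus>\<^bsub>T\<^esub> right_act R A t b"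
      by (intro T_eqI[OF right_act_linear linear_maps_sum[OF modT right_act_linear right_act_linear] _ t])
        (simp_all add: right_act_pure pure_simps r_distr)
  next
    fix r a assume ra: "r \<in> carrier R" "a \<in> carrier A"
    then show "right_act R A t (r \<odot>\<^bsub>A\<^esub> a) = r \<odot>\<^bsub>T\<^esub> right_act R A t a"
      by (intro T_eqI[OF right_act_linear linear_maps_scale[OF modT right_act_linear] _ t])
        (simp_all add: right_act_pure pure_simps smult_mult_right)
  qed (simp add: t linear_maps_closed[OF right_act_linear])
qed (rule right_act_linear)

lemmas act_simps = bilinear_maps_simps[OF left_act_bilinear] bilinear_maps_simps[OF right_act_bilinear]

lemma left_act_one: "t \<in> carrier T \<Longrightarrow> left_act R A \<one>\<^bsub>A\<^esub> t = t"
  by (induction t rule: T_induct) (simp_all add: left_act_pure act_simps)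

lemma right_act_one: "t \<in> carrier T \<Longrightarrow> right_act R A t \<one>\<^bsub>A\<^esub> = t"
  by (induction t rule: T_induct) (simp_all add: right_act_pure act_simps)

lemma left_act_mult:
  "t \<in> carrier T \<Longrightarrow> a \<in> carrier A \<Longrightarrow> b \<in> carrier A \<Longrightarrow>
    left_act R A (a \<otimes>\<^bsub>A\<^esub> b) t = left_act R A a (left_act R A b t)"
  by (induction t rule: T_induct) (simp_all add: left_act_pure act_simps m_assoc)

lemma right_act_mult:
  "t \<in> carrier T \<Longrightarrow> a \<in> carrier A \<Longrightarrow> b \<in> carrier A \<Longrightarrow>
    right_act R A t (a \<otimes>\<^bsub>A\<^esub> b) = right_act R A (right_act R A t a) b"
  by (induction t rule: T_induct) (simp_all add: right_act_pure act_simps m_assoc)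

lemma left_right_act:
  "t \<in> carrier T \<Longrightarrow> a \<in> carrier A \<Longrightarrow> b \<in> carrier A \<Longrightarrow>
    right_act R A (left_act R A a t) b = left_act R A a (right_act R A t b)"
  by (induction t rule: T_induct)
    (simp_all add: right_act_pure left_act_pure act_simps)

end

section \<open>Coassociativity of derivations\<close>

context unitary_algebra
begin

abbreviation "T\<^sub>3' \<equiv> tensor_prod R T A"
abbreviation "pure\<^sub>3' \<equiv> pure_tensor R T A"
abbreviation "assoc \<equiv> tensor_assoc R A"

lemma assoc_inner_bilinear:
  "c \<in> carrier A \<Longrightarrow> (\<lambda>a b. pure\<^sub>3 a (pure b c)) \<in> bilinear_maps R A A T\<^sub>3"
  by (intro bilinear_mapsI linear_mapsI) (simp_all add: pure_simps pure3_simps)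

lemmas assoc_inner_linear = tensor_lift_linear'[OF modA modA modT3 assoc_inner_bilinear]
lemmas assoc_inner_pure = tensor_lift_pure'[OF modA modA modT3 assoc_inner_bilinear]

text \<open>\<open>tensor_assoc\<close> nests one lift inside another, and the outer lift makes
  sense only if the inner one is bilinear in \<open>t\<close> and \<open>c\<close>. Linearity in
  \<open>t\<close> is that of a lift; linearity in \<open>c\<close> is compared on pure tensors
  \<open>t\<close>.\<close>

lemma assoc_bilinear:
  "(\<lambda>t c. tensor_lift R T\<^sub>3 (\<lambda>a b. pure\<^sub>3 a (pure b c)) t) \<in> bilinear_maps R T A T\<^sub>3"
proof (rule bilinear_mapsI)
  fix t assume t: "t \<in> carrier T"
  show "(\<lambda>c. tensor_lift R T\<^sub>3 (\<lambda>a b. pure\<^sub>3 a (pure b c)) t) \<in> linear_maps R A T\<^sub>3"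
  proof (rule linear_mapsI)
    fix c d assume "c \<in> carrier A" "d \<in> carrier A"
    then show "tensor_lift R T\<^sub>3 (\<lambda>a b. pure\<^sub>3 a (pure b (c \<oplus>\<^bsub>A\<^esub> d))) t =
        tensor_lift R T\<^sub>3 (\<lambda>a b. pure\<^sub>3 a (pure b c)) t \<oplus>\<^bsub>T\<^sub>3\<^esub>
        tensor_lift R T\<^sub>3 (\<lambda>a b. pure\<^sub>3 a (pure b d)) t"
      by (intro T_eqI[OF assoc_inner_linear
            linear_maps_sum[OF modT3 assoc_inner_linear assoc_inner_linear] _ t])
        (simp_all add: assoc_inner_pure pure_simps pure3_simps)
  next
    fix r c assume "r \<in> carrier R" "c \<in> carrier A"
    then show "tensor_lift R T\<^sub>3 (\<lambda>a b. pure\<^sub>3 a (pure b (r \<odot>\<^bsub>A\<^esub> c))) t =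
        r \<odot>\<^bsub>T\<^sub>3\<^esub> tensor_lift R T\<^sub>3 (\<lambda>a b. pure\<^sub>3 a (pure b c)) t"
      by (intro T_eqI[OF assoc_inner_linear linear_maps_scale[OF modT3 assoc_inner_linear] _ t])
        (simp_all add: assoc_inner_pure pure_simps pure3_simps)
  qed (simp add: t linear_maps_closed[OF assoc_inner_linear])
qed (rule assoc_inner_linear)

lemma assoc_linear: "assoc \<in> linear_maps R T\<^sub>3' T\<^sub>3"
  unfolding tensor_assoc_def Let_def
  by (intro tensor_lift_linear' modT modA modT3 assoc_bilinear)

lemma assoc_pure_lift:
  "t \<in> carrier T \<Longrightarrow> c \<in> carrier A \<Longrightarrow>
    assoc (pure\<^sub>3' t c) = tensor_lift R T\<^sub>3 (\<lambda>a b. pure\<^sub>3 a (pure b c)) t"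
  unfolding tensor_assoc_def Let_def
  by (simp add: tensor_lift_pure'[OF modT modA modT3 assoc_bilinear])

lemma assoc_pure:
  "a \<in> carrier A \<Longrightarrow> b \<in> carrier A \<Longrightarrow> c \<in> carrier A \<Longrightarrow>
    assoc (pure\<^sub>3' (pure a b) c) = pure\<^sub>3 a (pure b c)"
  by (simp add: assoc_pure_lift pure_simps assoc_inner_pure)

text \<open>Both ways of iterating the coproduct of a product \<open>ab\<close> produce the cross term
  \<open>inner_prod (\<Delta> a) (\<Delta> b)\<close>.\<close>

definition "left_act\<^sub>3 a = tensor_map R A T (\<lambda>x. a \<otimes>\<^bsub>A\<^esub> x) id"
definition "right_act\<^sub>3 a = tensor_map R A T id (\<lambda>t. right_act R A t a)"
text \<open>On pure tensors, u \<otimes> v and x \<otimes> y go to u \<otimes> (vx \<otimes> y): the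
  two adjacent inner factors are multiplied.\<close>

definition "inner_prod s t = tensor_map R A T id (\<lambda>v. left_act R A v t) s"

lemma left_act3_linear: "a \<in> carrier A \<Longrightarrow> left_act\<^sub>3 a \<in> linear_maps R T\<^sub>3 T\<^sub>3"
  unfolding left_act\<^sub>3_def
  by (intro tensor_map_linear mods linear_maps_id mult_left_linear)

lemma right_act3_linear: "a \<in> carrier A \<Longrightarrow> right_act\<^sub>3 a \<in> linear_maps R T\<^sub>3 T\<^sub>3"
  unfolding right_act\<^sub>3_def
  by (intro tensor_map_linear mods linear_maps_id right_act_linear)

lemmas left_act_linear' = bilinear_maps_linear(2)[OF left_act_bilinear]

lemma inner_prod_linear: "t \<in> carrier T \<Longrightarrow> (\<lambda>s. inner_prod s t) \<in> linear_maps R T T\<^sub>3"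
  unfolding inner_prod_def
  by (intro tensor_map_linear mods linear_maps_id left_act_linear')

lemma left_act3_pure:
  "a \<in> carrier A \<Longrightarrow> x \<in> carrier A \<Longrightarrow> t \<in> carrier T \<Longrightarrow>
    left_act\<^sub>3 a (pure\<^sub>3 x t) = pure\<^sub>3 (a \<otimes>\<^bsub>A\<^esub> x) t"
  by (simp add: left_act\<^sub>3_def tensor_map_pure mods linear_maps_id mult_left_linear)

lemma right_act3_pure:
  "a \<in> carrier A \<Longrightarrow> x \<in> carrier A \<Longrightarrow> t \<in> carrier T \<Longrightarrow>
    right_act\<^sub>3 a (pure\<^sub>3 x t) = pure\<^sub>3 x (right_act R A t a)"
  by (simp add: right_act\<^sub>3_def tensor_map_pure mods linear_maps_id right_act_linear)

lemma inner_prod_pure: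
  "u \<in> carrier A \<Longrightarrow> v \<in> carrier A \<Longrightarrow> t \<in> carrier T \<Longrightarrow>
    inner_prod (pure u v) t = pure\<^sub>3 u (left_act R A v t)"
  by (simp add: inner_prod_def tensor_map_pure mods linear_maps_id left_act_linear')

lemmas inner_prod_simps = linear_maps_simps[OF inner_prod_linear]
lemmas assoc_simps = linear_maps_simps[OF assoc_linear]
lemmas act3_simps = linear_maps_simps[OF left_act3_linear] linear_maps_simps[OF right_act3_linear]
lemmas tensor_simps = pure_simps pure3_simps pure3'_simps act_simps act3_simps inner_prod_simps
  assoc_simps assoc_pure left_act_pure right_act_pure left_act3_pure right_act3_pure inner_prod_pure

text \<open>Linearity as a tensor map concerns only the first argument; additivity in the second
  comes from the bilinearity of the action inside and needs induction on \<open>s\<close>.\<close>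

lemma inner_prod_add_right:
  assumes s: "s \<in> carrier T" and "t \<in> carrier T" "t' \<in> carrier T"
  shows "inner_prod s (t \<oplus>\<^bsub>T\<^esub> t') = inner_prod s t \<oplus>\<^bsub>T\<^sub>3\<^esub> inner_prod s t'"
  using s by (induction s rule: T_induct) (simp_all add: assms tensor_simps T\<^sub>3.a_ac)

lemma assoc_mult_right:
  assumes s: "s \<in> carrier T" and "y \<in> carrier A" "b \<in> carrier A"
  shows "assoc (pure\<^sub>3' s (y \<otimes>\<^bsub>A\<^esub> b)) = right_act\<^sub>3 b (assoc (pure\<^sub>3' s y))"
  using s by (induction s rule: T_induct) (simp_all add: assms tensor_simps)

lemma assoc_left_act:
  assumes s: "s \<in> carrier T" and "y \<in> carrier A" "a \<in> carrier A"
  shows "assoc (pure\<^sub>3' (left_act R A a s) y) = left_act\<^sub>3 a (assoc (pure\<^sub>3' s y))"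
  using s by (induction s rule: T_induct) (simp_all add: assms tensor_simps)

text \<open>After regrouping, the factor \<open>x\<close> multiplied onto the right end of
  \<open>s\<close> stands in the middle position. This is where the cross term arises for the left
  bracketing.\<close>

lemma assoc_right_act:
  assumes s: "s \<in> carrier T" and "x \<in> carrier A" "y \<in> carrier A"
  shows "assoc (pure\<^sub>3' (right_act R A s x) y) = inner_prod s (pure x y)"
  using s by (induction s rule: T_induct) (simp_all add: assms tensor_simps)

end

text \<open>Coassociativity is deliberately left out: it is derived in this setting for the forest
  coproduct, while the target bialgebra of the universal property is another instance and shares the
  remaining facts.\<close>

locale inf_comult = unitary_algebra R A for R (structure) and A (structure) +
  fixes \<Delta>
  assumes comult_linear: "\<Delta> \<in> linear_maps R A T"
    and comult_mult: "\<lbrakk>a \<in> carrier A; b \<in> carrier A\<rbrakk> \<Longrightarrow>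
      \<Delta> (a \<otimes>\<^bsub>A\<^esub> b) = left_act R A a (\<Delta> b) \<oplus>\<^bsub>T\<^esub> right_act R A (\<Delta> a) b"
begin

lemmas comult_simps = linear_maps_simps[OF comult_linear]

lemma comult_one: "\<Delta> \<one>\<^bsub>A\<^esub> = \<zero>\<^bsub>T\<^esub>"
proof -
  have "\<Delta> \<one>\<^bsub>A\<^esub> = \<Delta> \<one>\<^bsub>A\<^esub> \<oplus>\<^bsub>T\<^esub> \<Delta> \<one>\<^bsub>A\<^esub>"
    using comult_mult[of "\<one>\<^bsub>A\<^esub>" "\<one>\<^bsub>A\<^esub>"] by (simp add: comult_simps left_act_one right_act_one)
  then show ?thesis by (simp add: comult_simps)
qed

text \<open>The two sides of coassociativity as linear maps on all tensors, both landing in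
  \<open>T\<^sub>3\<close>, so that they can be studied by induction on pure tensors and not only at
  values of the coproduct.\<close>

definition "comult_left t = assoc (tensor_map R T A \<Delta> id t)"
definition "comult_right t = tensor_map R A T id \<Delta> t"

lemma comult_left_linear: "comult_left \<in> linear_maps R T T\<^sub>3"
  unfolding comult_left_def
  by (rule linear_maps_comp[OF tensor_map_linear assoc_linear])
    (rule mods comult_linear linear_maps_id)+

lemma comult_right_linear: "comult_right \<in> linear_maps R T T\<^sub>3"
  unfolding comult_right_def
  by (intro tensor_map_linear mods comult_linear linear_maps_id)

lemma comult_left_pure:
  "x \<in> carrier A \<Longrightarrow> y \<in> carrier A \<Longrightarrow> comult_left (pure x y) = assoc (pure\<^sub>3' (\<Delta> x) y)"
  by (simp add: comult_left_def tensor_map_pure mods comult_linear linear_maps_id)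

lemma comult_right_pure:
  "x \<in> carrier A \<Longrightarrow> y \<in> carrier A \<Longrightarrow> comult_right (pure x y) = pure\<^sub>3 x (\<Delta> y)"
  by (simp add: comult_right_def tensor_map_pure mods comult_linear linear_maps_id)

lemmas comult_lr_simps = linear_maps_simps[OF comult_left_linear]
  linear_maps_simps[OF comult_right_linear] comult_left_pure comult_right_pure

text \<open>The coproduct is applied to the second factor while \<open>a\<close> multiplies the
  first, so they do not interact. The same separation makes \<open>comult_left_right_act\<close>
  free of a cross term.\<close>

lemma comult_right_left_act:
  assumes "t \<in> carrier T" and "a \<in> carrier A"
  shows "comult_right (left_act R A a t) = left_act\<^sub>3 a (comult_right t)"
  using assms(1)
  by (induction t rule: T_induct) (simp_all add: assms(2) tensor_simps comult_simps comult_lr_simps)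

lemma comult_left_right_act:
  assumes "t \<in> carrier T" and "a \<in> carrier A"
  shows "comult_left (right_act R A t a) = right_act\<^sub>3 a (comult_left t)"
  using assms(1)
  by (induction t rule: T_induct)
    (simp_all add: assms(2) tensor_simps comult_simps comult_lr_simps assoc_mult_right)

text \<open>Now coproduct and multiplication meet in the first factor. The derivation rule for ax
  splits off \<Delta> a acted on by x from the right, which regroups to the cross term.\<close>

lemma comult_left_left_act:
  assumes "t \<in> carrier T" and "a \<in> carrier A"
  shows "comult_left (left_act R A a t) = left_act\<^sub>3 a (comult_left t) \<oplus>\<^bsub>T\<^sub>3\<^esub> inner_prod (\<Delta> a) t"
  using assms(1)
  by (induction t rule: T_induct)
    (simp_all add: assms(2) tensor_simps comult_simps comult_lr_simps comult_mult
      assoc_left_act assoc_right_act inner_prod_add_right T\<^sub>3.a_ac)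

text \<open>Coproduct and multiplication meet in the second factor. In the derivation rule for ya,
  the summand y acting on \<Delta> a gives the cross term.\<close>

lemma comult_right_right_act:
  assumes "t \<in> carrier T" and "a \<in> carrier A"
  shows "comult_right (right_act R A t a) =
    inner_prod t (\<Delta> a) \<oplus>\<^bsub>T\<^sub>3\<^esub> right_act\<^sub>3 a (comult_right t)"
  using assms(1)
  by (induction t rule: T_induct)
    (simp_all add: assms(2) tensor_simps comult_simps comult_lr_simps comult_mult T\<^sub>3.a_ac)

text \<open>Both sides expand to three summands in the same order: \<open>a\<close> acting on an
  iterated coproduct of \<open>b\<close>, the common cross term, and an iterated coproduct of
  \<open>a\<close> acted on by \<open>b\<close>. The hypotheses identify the outer two.\<close>

lemma coassoc_mult:
  assumes "a \<in> carrier A" "b \<in> carrier A"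
    and "comult_left (\<Delta> a) = comult_right (\<Delta> a)" "comult_left (\<Delta> b) = comult_right (\<Delta> b)"
  shows "comult_left (\<Delta> (a \<otimes>\<^bsub>A\<^esub> b)) = comult_right (\<Delta> (a \<otimes>\<^bsub>A\<^esub> b))"
  by (simp add: assms comult_mult comult_simps comult_lr_simps act_simps tensor_simps T\<^sub>3.a_assoc
      comult_right_left_act comult_left_right_act comult_left_left_act comult_right_right_act)

text \<open>Both sides become \<Delta> a \<otimes> 1 plus \<open>P\<^sub>3\<close> of an iterated
  coproduct of \<open>a\<close>. On the left the first term comes from the summand a \<otimes> 1; on
  the right that summand dies with \<Delta> 1 = 0, and the term is supplied by
  \<open>comult_right\<close> of \<open>P\<^sub>2\<close>.\<close>

lemma coassoc_cocycle:
  assumes P: "P \<in> linear_maps R A A"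
    and cocycle: "\<And>a. a \<in> carrier A \<Longrightarrow> \<Delta> (P a) = pure a \<one>\<^bsub>A\<^esub> \<oplus>\<^bsub>T\<^esub> tensor_map R A A id P (\<Delta> a)"
    and a: "a \<in> carrier A" and IH: "comult_left (\<Delta> a) = comult_right (\<Delta> a)"
  shows "comult_left (\<Delta> (P a)) = comult_right (\<Delta> (P a))"
proof -
  define P\<^sub>2 where "P\<^sub>2 = tensor_map R A A id P"
  define P\<^sub>3 where "P\<^sub>3 = tensor_map R A T id P\<^sub>2"
  have P2: "P\<^sub>2 \<in> linear_maps R T T"
    unfolding P\<^sub>2_def by (intro tensor_map_linear mods linear_maps_id P)
  have P3: "P\<^sub>3 \<in> linear_maps R T\<^sub>3 T\<^sub>3"
    unfolding P\<^sub>3_def by (intro tensor_map_linear mods linear_maps_id P2)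
  have P2_pure: "P\<^sub>2 (pure x y) = pure x (P y)" if "x \<in> carrier A" "y \<in> carrier A" for x y
    using that by (simp add: P\<^sub>2_def tensor_map_pure mods linear_maps_id P)
  have P3_pure: "P\<^sub>3 (pure\<^sub>3 x t) = pure\<^sub>3 x (P\<^sub>2 t)" if "x \<in> carrier A" "t \<in> carrier T" for x t
    using that by (simp add: P\<^sub>3_def tensor_map_pure mods linear_maps_id P2)
  note P_simps = linear_maps_simps[OF P] linear_maps_simps[OF P2] linear_maps_simps[OF P3]
    P2_pure P3_pure
  \<comment> \<open>The operator acts on the last factor, and regrouping keeps that factor
    last.\<close>
  have 1: "assoc (pure\<^sub>3' s (P y)) = P\<^sub>3 (assoc (pure\<^sub>3' s y))" if "s \<in> carrier T" "y \<in> carrier A" for s y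
    using that(1) by (induction s rule: T_induct) (simp_all add: that(2) tensor_simps P_simps)
  have 2: "comult_left (P\<^sub>2 t) = P\<^sub>3 (comult_left t)" if "t \<in> carrier T" for t
    using that
    by (induction t rule: T_induct) (simp_all add: tensor_simps P_simps comult_lr_simps comult_simps 1)
  \<comment> \<open>For a pure tensor x \<otimes> y the cocycle equation for \<open>P y\<close>
    contributes x \<otimes> (y \<otimes> 1), which is the regrouping of (x \<otimes> y) \<otimes>
    1.\<close>
  have 3: "comult_right (P\<^sub>2 t) = assoc (pure\<^sub>3' t \<one>\<^bsub>A\<^esub>) \<oplus>\<^bsub>T\<^sub>3\<^esub> P\<^sub>3 (comult_right t)"
    if "t \<in> carrier T" for t
    using that
    by (induction t rule: T_induct)
      (simp_all add: tensor_simps P_simps comult_lr_simps comult_simps T\<^sub>3.a_ac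
        cocycle[folded P\<^sub>2_def])
  show ?thesis
    using a IH
    by (simp add: pure3_zero cocycle[folded P\<^sub>2_def] comult_lr_simps comult_simps P_simps tensor_simps 2 3 comult_one)
qed

end

section \<open>The bialgebra of forests\<close>

lemma forests_Nil: "[] \<in> forests X \<sigma>"
  by (simp add: forests_def)

lemma forests_append: "u @ v \<in> forests X \<sigma> \<longleftrightarrow> u \<in> forests X \<sigma> \<and> v \<in> forests X \<sigma>"
  by (simp add: forests_def)

lemma forests_Cons: "t # u \<in> forests X \<sigma> \<longleftrightarrow> [t] \<in> forests X \<sigma> \<and> u \<in> forests X \<sigma>"
  using forests_append[of "[t]" u] by simp

lemma forests_leaf: "x \<in> X \<Longrightarrow> [Node x []] \<in> forests X \<sigma>"
  by (simp add: forests_def)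

lemma forests_graft: "[Node \<sigma> u] \<in> forests X \<sigma> \<longleftrightarrow> u \<in> forests X \<sigma>"
  by (auto simp: forests_def)

text \<open>The nested recursion is taken apart: induction along a list reduces the claim to its
  single trees, and structural induction on a tree supplies the hypothesis for the list of its
  subtrees. The vertex decorated by \<open>\<sigma>\<close> is covered as the grafting of the empty
  forest.\<close>

lemma forests_induct [consumes 1, case_names Nil leaf graft Cons]:
  assumes "u \<in> forests X \<sigma>"
    and Nil: "P []"
    and leaf: "\<And>x. x \<in> X \<Longrightarrow> P [Node x []]"
    and graft: "\<And>u. u \<in> forests X \<sigma> \<Longrightarrow> P u \<Longrightarrow> P [Node \<sigma> u]"
    and Cons: "\<And>t u. [t] \<in> forests X \<sigma> \<Longrightarrow> u \<in> forests X \<sigma> \<Longrightarrow> P [t] \<Longrightarrow> P u \<Longrightarrow> P (t # u)"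
  shows "P u"
proof -
  have list: "P u" if "u \<in> forests X \<sigma>" "\<And>t. t \<in> set u \<Longrightarrow> [t] \<in> forests X \<sigma> \<Longrightarrow> P [t]" for u
    using that
  proof (induction u)
    case (Cons t u)
    then have "[t] \<in> forests X \<sigma>" "u \<in> forests X \<sigma>"
      by (simp_all add: forests_Cons[of t u])
    moreover from this have "P [t]" "P u"
      using Cons.IH Cons.prems(2) by simp_all
    ultimately show ?case by (rule assms(5))
  qed (rule Nil)
  have tree: "P [t]" if "[t] \<in> forests X \<sigma>" for t
    using that
  proof (induction t)
    case (Node d ts)
    show ?case
    proof (cases "d = \<sigma>")
      case True
      then have "ts \<in> forests X \<sigma>" using Node.prems by (simp add: forests_graft)
      then have "P ts" by (rule list) (rule Node.IH)
      with \<open>ts \<in> forests X \<sigma>\<close> show ?thesis unfolding True by (rule graft)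
    next
      case False
      \<comment> \<open>Inner vertices carry \<open>\<sigma>\<close>, so a root with another
        decoration lies in \<open>X\<close> and has no subtrees.\<close>
      then show ?thesis using Node.prems leaf[of d] by (cases ts) (auto simp: forests_def)
    qed
  qed
  show ?thesis using assms(1) tree by (rule list)
qed

section \<open>The forest algebra\<close>

lemma H_alg_simps:
  "carrier (H_alg R X \<sigma>) = carrier (free_module R (forests X \<sigma>))"
  "add (H_alg R X \<sigma>) = add (free_module R (forests X \<sigma>))"
  "zero (H_alg R X \<sigma>) = zero (free_module R (forests X \<sigma>))"
  "smult (H_alg R X \<sigma>) = smult (free_module R (forests X \<sigma>))"
  by (simp_all add: H_alg_def Let_def)

lemma H_alg_one: "\<one>\<^bsub>H_alg R X \<sigma>\<^esub> = basis_elem R []"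
  by (simp add: H_alg_def Let_def)

text \<open>The module axioms speak only of the additive structure and the scalar action, which are
  those of the free module; the record update changes just \<open>mult\<close> and
  \<open>one\<close>.\<close>

lemma H_alg_module:
  assumes "cring R"
  shows "module R (H_alg R X \<sigma>)"
  using free_module_module[OF assms, of "forests X \<sigma>"]
  by (simp add: module_def abelian_group_def abelian_monoid_def abelian_group_axioms_def
      module_axioms_def H_alg_simps)

lemma linear_maps_H_alg:
  "linear_maps R (H_alg R X \<sigma>) N = linear_maps R (free_module R (forests X \<sigma>)) N"
  "linear_maps R M (H_alg R X \<sigma>) = linear_maps R M (free_module R (forests X \<sigma>))"
  by (simp_all add: linear_maps_def H_alg_simps)

text \<open>The product is defined through extensions into the bare free module. Finite sums depend
  only on the additive structure, so they can be taken in the algebra itself.\<close>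

lemma lin_ext_H_alg: "lin_ext R (free_module R (forests X \<sigma>)) = lin_ext R (H_alg R X \<sigma>)"
  by (simp add: lin_ext_def finsum_def H_alg_simps fun_eq_iff)

lemma H_alg_mult:
  "a \<otimes>\<^bsub>H_alg R X \<sigma>\<^esub> b =
    lin_ext R (H_alg R X \<sigma>) (\<lambda>u. lin_ext R (H_alg R X \<sigma>) (\<lambda>v. basis_elem R (u @ v)) b) a"
  unfolding lin_ext_H_alg[symmetric] by (simp add: H_alg_def Let_def)

locale forest_algebra =
  fixes R :: "('r, 'q) ring_scheme" and X :: "'x set" and \<sigma> :: 'x
  assumes cring: "cring R" and sigma: "\<sigma> \<notin> X"
begin

abbreviation "B \<equiv> forests X \<sigma>"
abbreviation "H \<equiv> H_alg R X \<sigma>"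
abbreviation "e \<equiv> basis_elem R"

lemma modH: "module R H"
  using cring by (rule H_alg_module)

sublocale H: module R H by (rule modH)

lemma e_closed: "u \<in> B \<Longrightarrow> e u \<in> carrier H"
  using cring by (simp add: H_alg_simps basis_elem_closed)

lemma H_induct [consumes 1, case_names basis add smult]:
  assumes "c \<in> carrier H"
    and basis: "\<And>u. u \<in> B \<Longrightarrow> P (e u)"
    and add: "\<And>c d. c \<in> carrier H \<Longrightarrow> d \<in> carrier H \<Longrightarrow> P c \<Longrightarrow> P d \<Longrightarrow> P (c \<oplus>\<^bsub>H\<^esub> d)"
    and smult: "\<And>r c. r \<in> carrier R \<Longrightarrow> c \<in> carrier H \<Longrightarrow> P c \<Longrightarrow> P (r \<odot>\<^bsub>H\<^esub> c)"
  shows "P c"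
  using cring assms(1)[unfolded H_alg_simps]
proof (induction rule: free_module_induct)
  case zero
  \<comment> \<open>Zero is obtained as the zero multiple of the empty forest, which saves a
    separate case.\<close>
  have "P (\<zero>\<^bsub>R\<^esub> \<odot>\<^bsub>H\<^esub> e [])"
    by (intro basis smult) (simp_all add: e_closed forests_Nil)
  then show ?case by (simp add: e_closed forests_Nil) (simp add: H_alg_simps)
next
  case (basis r u)
  then show ?case
    using smult[of r "e u"] assms(2)[of u] e_closed[of u] by (simp add: H_alg_simps)
next
  case (add c d)
  then show ?case using assms(3)[of c d] by (simp add: H_alg_simps)
qed

lemma ext_linear:
  assumes "module R N" "\<And>u. u \<in> B \<Longrightarrow> \<phi> u \<in> carrier N"
  shows "lin_ext R N \<phi> \<in> linear_maps R H N"
  unfolding linear_maps_H_alg using assms by (intro lin_ext_linear) auto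

lemma ext_e:
  assumes "module R N" "\<And>u. u \<in> B \<Longrightarrow> \<phi> u \<in> carrier N" "u \<in> B"
  shows "lin_ext R N \<phi> (e u) = \<phi> u"
  using assms by (simp add: lin_ext_basis_elem)

lemma mult_inner_linear: "u \<in> B \<Longrightarrow> lin_ext R H (\<lambda>v. e (u @ v)) \<in> linear_maps R H H"
  by (intro ext_linear modH) (simp add: e_closed forests_append)

lemma mult_left_linear': "b \<in> carrier H \<Longrightarrow> (\<lambda>a. a \<otimes>\<^bsub>H\<^esub> b) \<in> linear_maps R H H"
  unfolding H_alg_mult
  by (intro ext_linear modH) (simp add: linear_maps_closed[OF mult_inner_linear])

lemma e_mult: "u \<in> B \<Longrightarrow> b \<in> carrier H \<Longrightarrow> e u \<otimes>\<^bsub>H\<^esub> b = lin_ext R H (\<lambda>v. e (u @ v)) b"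
  unfolding H_alg_mult
  by (rule ext_e) (simp_all add: modH linear_maps_closed[OF mult_inner_linear])

lemma e_mult_e: "u \<in> B \<Longrightarrow> v \<in> B \<Longrightarrow> e u \<otimes>\<^bsub>H\<^esub> e v = e (u @ v)"
  by (simp add: e_mult e_closed ext_e modH forests_append)

text \<open>The outer extension gives linearity in the left factor. In the right factor, the inner
  extension gives linearity when the left factor is a basis forest, and induction on
  \<open>a\<close> spreads it to all left factors.\<close>

lemma mult_bilinear: "mult H \<in> bilinear_maps R H H H"
proof (rule bilinear_mapsI)
  fix a assume a: "a \<in> carrier H"
  note [simp] = linear_maps_simps[OF mult_left_linear'] linear_maps_simps[OF mult_inner_linear] e_mult
  show "mult H a \<in> linear_maps R H H"
  proof (rule linear_mapsI)
    fix b c assume "b \<in> carrier H" "c \<in> carrier H"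
    with a show "a \<otimes>\<^bsub>H\<^esub> (b \<oplus>\<^bsub>H\<^esub> c) = a \<otimes>\<^bsub>H\<^esub> b \<oplus>\<^bsub>H\<^esub> a \<otimes>\<^bsub>H\<^esub> c"
      by (induction a rule: H_induct) (simp_all add: H.a_ac H.smult_r_distr)
  next
    fix r b assume "r \<in> carrier R" "b \<in> carrier H"
    with a show "a \<otimes>\<^bsub>H\<^esub> (r \<odot>\<^bsub>H\<^esub> b) = r \<odot>\<^bsub>H\<^esub> (a \<otimes>\<^bsub>H\<^esub> b)"
      by (induction a rule: H_induct)
        (simp_all add: H.smult_r_distr H.smult_assoc1[symmetric] H.R.m_comm)
  qed (simp add: a)
qed (rule mult_left_linear')

lemmas mult_simps = bilinear_maps_simps[OF mult_bilinear]

lemma one_closed: "\<one>\<^bsub>H\<^esub> \<in> carrier H"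
  by (simp add: H_alg_one e_closed forests_Nil)

lemma one_mult: "a \<in> carrier H \<Longrightarrow> \<one>\<^bsub>H\<^esub> \<otimes>\<^bsub>H\<^esub> a = a"
  by (induction a rule: H_induct)
    (simp_all add: mult_simps one_closed, simp add: H_alg_one e_mult_e forests_Nil)

lemma mult_one: "a \<in> carrier H \<Longrightarrow> a \<otimes>\<^bsub>H\<^esub> \<one>\<^bsub>H\<^esub> = a"
  by (induction a rule: H_induct)
    (simp_all add: mult_simps one_closed, simp add: H_alg_one e_mult_e forests_Nil)

text \<open>Associativity of list concatenation, extended by linearity in one factor after the
  other.\<close>

lemma mult_assoc:
  assumes a: "a \<in> carrier H" and b: "b \<in> carrier H" and c: "c \<in> carrier H"
  shows "a \<otimes>\<^bsub>H\<^esub> b \<otimes>\<^bsub>H\<^esub> c = a \<otimes>\<^bsub>H\<^esub> (b \<otimes>\<^bsub>H\<^esub> c)"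
proof -
  have 1: "e u \<otimes>\<^bsub>H\<^esub> e v \<otimes>\<^bsub>H\<^esub> c = e u \<otimes>\<^bsub>H\<^esub> (e v \<otimes>\<^bsub>H\<^esub> c)" if "u \<in> B" "v \<in> B" for u v
    using c by (induction c rule: H_induct)
      (simp_all add: that e_closed e_mult_e mult_simps forests_append)
  have 2: "e u \<otimes>\<^bsub>H\<^esub> b \<otimes>\<^bsub>H\<^esub> c = e u \<otimes>\<^bsub>H\<^esub> (b \<otimes>\<^bsub>H\<^esub> c)" if "u \<in> B" for u
    using b by (induction b rule: H_induct)
      (simp_all add: 1 that c e_closed mult_simps)
  show ?thesis
    using a by (induction a rule: H_induct)
      (simp_all add: 2 b c mult_simps)
qed

lemma H_ring: "ring H"
proof (rule ringI)
  show "monoid H"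
    by (rule monoidI) (simp_all add: mult_simps one_closed one_mult mult_one mult_assoc)
qed (simp_all add: mult_simps H.abelian_group_axioms)

sublocale unitary_algebra R H
  by (intro unitary_algebra.intro modH H_ring unitary_algebra_axioms.intro) (simp_all add: mult_simps)

section \<open>Grafting and the coproduct on forests\<close>

abbreviation "Bp \<equiv> B_plus R X \<sigma>"

lemma Bp_linear: "Bp \<in> linear_maps R H H"
  unfolding B_plus_def by (intro ext_linear modH) (simp add: e_closed forests_graft)

lemma Bp_e: "u \<in> B \<Longrightarrow> Bp (e u) = e [Node \<sigma> u]"
  unfolding B_plus_def by (rule ext_e) (simp_all add: modH e_closed forests_graft)

abbreviation "Df \<equiv> Delta_forest R X \<sigma>"
abbreviation "D \<equiv> Delta_eps R X \<sigma>"

definition "Bp\<^sub>2 = tensor_map R H H id Bp"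

lemma Bp2_linear: "Bp\<^sub>2 \<in> linear_maps R T T"
  unfolding Bp\<^sub>2_def by (intro tensor_map_linear modA linear_maps_id Bp_linear)

lemma Df_leaf: "x \<in> X \<Longrightarrow> Df [Node x ts] = pure \<one>\<^bsub>H\<^esub> \<one>\<^bsub>H\<^esub>"
  by (simp add: Let_def)

text \<open>The assumption that \<open>\<sigma>\<close> is not in \<open>X\<close> selects the
  grafting branch of the definition.\<close>

lemma Df_graft: "Df [Node \<sigma> ts] = pure (e ts) \<one>\<^bsub>H\<^esub> \<oplus>\<^bsub>T\<^esub> Bp\<^sub>2 (Df ts)"
  using sigma by (simp add: Let_def Bp\<^sub>2_def)

text \<open>The definition treats one tree and several trees separately. The rule for several trees
  also holds for empty \<open>u\<close>: the coproduct of the empty forest is zero and acting by the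
  unit changes nothing. Membership of \<open>Df [t]\<close> is assumed here because
  \<open>Df_closed\<close> itself rests on this lemma.\<close>

lemma Df_Cons_aux:
  assumes "[t] \<in> B" "Df [t] \<in> carrier T"
  shows "Df (t # u) = left_act R H (e [t]) (Df u) \<oplus>\<^bsub>T\<^esub> right_act R H (Df [t]) (e u)"
proof (cases u)
  case Nil
  have "left_act R H (e [t]) \<zero>\<^bsub>T\<^esub> = \<zero>\<^bsub>T\<^esub>"
    by (rule linear_maps_zero[OF modT modT left_act_linear]) (simp add: assms e_closed)
  then show ?thesis
    using Nil assms right_act_one[of "Df [t]"] by (simp add: H_alg_one)
next
  case (Cons s v)
  then show ?thesis by (simp add: Let_def)
qed

lemma Df_closed: "u \<in> B \<Longrightarrow> Df u \<in> carrier T"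
proof (induction u rule: forests_induct)
  case (graft u)
  then show ?case
    unfolding Df_graft
    by (simp add: pure_simps e_closed one_closed linear_maps_closed[OF Bp2_linear])
next
  case (Cons t u)
  then show ?case by (simp add: Df_Cons_aux[of t u] act_simps e_closed del: Delta_forest.simps)
qed (simp_all add: pure_simps one_closed Let_def)

lemmas Df_Cons = Df_Cons_aux[OF _ Df_closed]

text \<open>From splitting off one tree to splitting anywhere: the recursion expands both sides into
  three terms that match by the bimodule laws, with \<open>left_right_act\<close> needed for the
  middle one.\<close>

lemma Df_append:
  assumes "u \<in> B" "v \<in> B"
  shows "Df (u @ v) = left_act R H (e u) (Df v) \<oplus>\<^bsub>T\<^esub> right_act R H (Df u) (e v)"
  using assms(1)
proof (induction u)
  case Nil
  have "right_act R H \<zero>\<^bsub>T\<^esub> (e v) = \<zero>\<^bsub>T\<^esub>"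
    by (rule linear_maps_zero[OF modT modT right_act_linear]) (simp add: assms e_closed)
  then show ?case
    using left_act_one[of "Df v"] Df_closed[OF assms(2)] by (simp add: H_alg_one)
next
  case (Cons t u)
  then have t: "[t] \<in> B" and u: "u \<in> B" by (simp_all add: forests_Cons[of t u])
  have tu: "e (t # u) = e [t] \<otimes>\<^bsub>H\<^esub> e u" and uv: "e (u @ v) = e u \<otimes>\<^bsub>H\<^esub> e v"
    using t u assms(2) by (simp_all add: e_mult_e)
  show ?case
    using t u assms(2) Cons.IH[OF u]
    by (simp add: Df_Cons[of t u] Df_Cons[of t "u @ v"] forests_append act_simps e_closed Df_closed tu uv T.a_assoc
        left_act_mult right_act_mult left_right_act del: Delta_forest.simps)
qed

lemma D_linear: "D \<in> linear_maps R H T"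
  unfolding Delta_eps_def by (intro ext_linear modT Df_closed)

lemma D_e: "u \<in> B \<Longrightarrow> D (e u) = Df u"
  unfolding Delta_eps_def by (rule ext_e) (simp_all add: modT Df_closed)

lemmas D_simps = linear_maps_simps[OF D_linear]

text \<open>For two basis forests this is \<open>Df_append\<close>; linearity extends it to all
  \<open>b\<close> and then to all \<open>a\<close>.\<close>

lemma D_mult:
  assumes a: "a \<in> carrier H" and b: "b \<in> carrier H"
  shows "D (a \<otimes>\<^bsub>H\<^esub> b) = left_act R H a (D b) \<oplus>\<^bsub>T\<^esub> right_act R H (D a) b"
proof -
  have 1: "D (e u \<otimes>\<^bsub>H\<^esub> b) = left_act R H (e u) (D b) \<oplus>\<^bsub>T\<^esub> right_act R H (D (e u)) b" if "u \<in> B" for u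
    using b by (induction b rule: H_induct)
      (simp_all add: that e_mult_e D_e Df_append forests_append mult_simps D_simps act_simps
        e_closed Df_closed T.a_ac T.smult_r_distr)
  show ?thesis
    using a by (induction a rule: H_induct)
      (simp_all add: 1 b mult_simps D_simps act_simps T.a_ac T.smult_r_distr)
qed

sublocale inf_comult R H D
  by (intro inf_comult.intro unitary_algebra_axioms inf_comult_axioms.intro D_linear D_mult)

lemma D_cocycle:
  assumes "a \<in> carrier H"
  shows "D (Bp a) = pure a \<one>\<^bsub>H\<^esub> \<oplus>\<^bsub>T\<^esub> Bp\<^sub>2 (D a)"
  using assms
  by (induction a rule: H_induct)
    (simp_all add: Bp_e D_e Df_graft forests_graft linear_maps_simps[OF Bp_linear] D_simps pure_simps
      one_closed linear_maps_simps[OF Bp2_linear] T.a_ac T.smult_r_distr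
      del: Delta_forest.simps)

lemma coassoc_e:
  assumes "u \<in> B"
  shows "comult_left (D (e u)) = comult_right (D (e u))"
  using assms
proof (induction u rule: forests_induct)
  case Nil
  then show ?case
    using linear_maps_zero[OF modT modT3 comult_left_linear]
      linear_maps_zero[OF modT modT3 comult_right_linear]
    by (simp add: D_e forests_Nil)
next
  case (leaf x)
  then show ?case
    \<comment> \<open>The coproduct of a leaf is 1 \<otimes> 1, and both iterated coproducts vanish
      since \<Delta> 1 = 0.\<close>
    by (simp add: D_e forests_leaf Df_leaf comult_lr_simps one_closed comult_one pure3_zero pure3'_zero
        linear_maps_zero[OF modT3' modT3 assoc_linear] del: Delta_forest.simps)
next
  case (graft u)
  then show ?case
    using coassoc_cocycle[OF Bp_linear D_cocycle[unfolded Bp\<^sub>2_def], of "e u"] by (simp add: e_closed Bp_e)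
next
  case (Cons t u)
  then show ?case
    using coassoc_mult[of "e [t]" "e u"] by (simp add: e_closed e_mult_e)
qed

lemma coassoc:
  assumes "a \<in> carrier H"
  shows "comult_left (D a) = comult_right (D a)"
  using assms
  by (induction a rule: H_induct) (simp_all add: coassoc_e D_simps comult_lr_simps)

lemma H_cocycle_bialgebra: "cocycle_eps_unitary_bialgebra R H D Bp"
proof unfold_locales
  fix a assume "a \<in> carrier H"
  then show "tensor_assoc R H (tensor_map R T H D id (D a)) = tensor_map R H T id D (D a)"
    using coassoc by (simp add: comult_left_def comult_right_def)
qed (simp_all add: D_linear D_mult Bp_linear D_cocycle[unfolded Bp\<^sub>2_def])

end

section \<open>The universal property\<close>

text \<open>One recursion serves trees and forests alike by peeling off the first tree. A single
  tree therefore carries a trailing factor \<open>\<one>\<close>, which disappears only once the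
  value is known to lie in the carrier.\<close>

fun forest_map ::
  "('h, 'e) ring_scheme \<Rightarrow> ('h \<Rightarrow> 'h) \<Rightarrow> 'd set \<Rightarrow> ('d \<Rightarrow> 'h) \<Rightarrow> 'd rtree list \<Rightarrow> 'h"
  where
    "forest_map A P X f [] = \<one>\<^bsub>A\<^esub>"
  | "forest_map A P X f (Node d ts # us) =
      (if d \<in> X then f d else P (forest_map A P X f ts)) \<otimes>\<^bsub>A\<^esub> forest_map A P X f us"

locale cocycle_target = forest_algebra R X \<sigma> +
  A: cocycle_eps_unitary_bialgebra R A \<Delta> P
  for R :: "('r, 'q) ring_scheme" and X :: "'x set" and \<sigma> :: 'x
    and A :: "('r, 'h, 'e) module_scheme" and \<Delta> and P +
  fixes f
  assumes f_closed: "\<And>x. x \<in> X \<Longrightarrow> f x \<in> carrier A"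
    and comult_f: "\<And>x. x \<in> X \<Longrightarrow> \<Delta> (f x) = A.pure \<one>\<^bsub>A\<^esub> \<one>\<^bsub>A\<^esub>"
begin

sublocale A: inf_comult R A \<Delta>
  by unfold_locales (simp_all add: A.comult_linear A.comult_mult)

abbreviation "F \<equiv> forest_map A P X f"

lemma P_linear: "P \<in> linear_maps R A A"
  by (rule A.operator_linear)

lemmas P_simps = linear_maps_simps[OF P_linear]

lemma root_in_X: "Node d ts # u \<in> B \<Longrightarrow> d \<in> X \<or> d = \<sigma> \<and> ts \<in> B"
  by (auto simp: forests_def)

lemma F_closed: "u \<in> B \<Longrightarrow> F u \<in> carrier A"
\<comment> \<open>Splitting \<open>F (t # u)\<close> into \<open>F [t]\<close> and
  \<open>F u\<close> already presupposes closedness, so the induction follows the recursion instead;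
  the total size drops for the remaining forest and for the subtrees of the first tree.\<close>
proof (induction u rule: measure_induct_rule[of "size_list size"])
  case (less u)
  show ?case
  proof (cases u)
    case (Cons t v)
    obtain d ts where t: "t = Node d ts" by (cases t)
    have "v \<in> B" "d \<in> X \<or> d = \<sigma> \<and> ts \<in> B"
      using less.prems root_in_X[of d ts v] by (auto simp: Cons t forests_Cons[of _ v])
    then show ?thesis
      using less.IH[of v] less.IH[of ts] sigma by (auto simp: Cons t f_closed P_simps)
  qed simp
qed

lemma F_leaf: "x \<in> X \<Longrightarrow> F [Node x []] = f x"
  by (simp add: f_closed)

lemma F_graft: "u \<in> B \<Longrightarrow> F [Node \<sigma> u] = P (F u)"
  using sigma by (simp add: F_closed P_simps)

lemma F_Cons:
  assumes "[t] \<in> B"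
  shows "F (t # u) = F [t] \<otimes>\<^bsub>A\<^esub> F u"
proof (cases t)
  case (Node d ts)
  then show ?thesis
    using root_in_X[of d ts "[]"] assms sigma by (auto simp: f_closed P_simps F_closed)
qed

lemma F_append: "u \<in> B \<Longrightarrow> v \<in> B \<Longrightarrow> F (u @ v) = F u \<otimes>\<^bsub>A\<^esub> F v"
proof (induction u)
  case (Cons t u)
  then have t: "[t] \<in> B" and u: "u \<in> B" by (simp_all add: forests_Cons[of t u])
  then show ?case
    using Cons F_Cons[OF t, of u] F_Cons[OF t, of "u @ v"]
    by (simp add: F_closed A.m_assoc del: forest_map.simps)
qed (simp add: F_closed)

section \<open>Uniqueness of the morphism\<close>

lemma morphism_eq_forest_map:
  assumes "operated_eps_morphism R H D Bp A \<Delta> P \<psi>"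
    and \<psi>_f: "\<And>x. x \<in> X \<Longrightarrow> \<psi> (single_vertex R x) = f x"
    and "u \<in> B"
  shows "\<psi> (e u) = F u"
proof -
  have hom: "\<psi> \<in> ring_hom H A" and P: "\<And>a. a \<in> carrier H \<Longrightarrow> \<psi> (Bp a) = P (\<psi> a)"
    using assms(1) by (auto simp: operated_eps_morphism_def)
  show ?thesis
    using assms(3)
  proof (induction u rule: forests_induct)
    case Nil
    then show ?case using ring_hom_one[OF hom] by (simp add: H_alg_one)
  next
    case (leaf x)
    then show ?case using \<psi>_f F_leaf by (simp add: single_vertex_def)
  next
    case (graft u)
    then show ?case using P[of "e u"] F_graft by (simp add: Bp_e e_closed)
  next
    case (Cons t u)
    then show ?case
      using ring_hom_mult[OF hom, of "e [t]" "e u"] F_Cons[of t u] by (simp add: e_mult_e e_closed)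
  qed
qed

section \<open>Existence: the linear extension respects all structure\<close>

context
  fixes \<psi>
  assumes \<psi>: "\<psi> \<in> linear_maps R H A" and \<psi>_e: "\<And>u. u \<in> B \<Longrightarrow> \<psi> (e u) = F u"
begin

lemmas \<psi>_simps = linear_maps_simps[OF \<psi>]

lemma \<psi>_mult:
  assumes a: "a \<in> carrier H" and b: "b \<in> carrier H"
  shows "\<psi> (a \<otimes>\<^bsub>H\<^esub> b) = \<psi> a \<otimes>\<^bsub>A\<^esub> \<psi> b"
proof -
  have 1: "\<psi> (e u \<otimes>\<^bsub>H\<^esub> b) = \<psi> (e u) \<otimes>\<^bsub>A\<^esub> \<psi> b" if "u \<in> B" for u
    using b by (induction b rule: H_induct)
      (simp_all add: that e_mult_e \<psi>_e F_append forests_append mult_simps \<psi>_simps e_closed F_closed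
        A.r_distr A.smult_mult_right)
  show ?thesis
    using a by (induction a rule: H_induct)
      (simp_all add: 1 b mult_simps \<psi>_simps A.l_distr A.smult_mult_left)
qed

lemma \<psi>_one: "\<psi> \<one>\<^bsub>H\<^esub> = \<one>\<^bsub>A\<^esub>"
  by (simp add: H_alg_one \<psi>_e forests_Nil)

lemma \<psi>_Bp: "a \<in> carrier H \<Longrightarrow> \<psi> (Bp a) = P (\<psi> a)"
  by (induction a rule: H_induct)
    (simp_all add: \<psi>_simps Bp_e \<psi>_e F_graft forests_graft P_simps linear_maps_simps[OF Bp_linear]
      del: forest_map.simps)

definition "\<psi>\<^sub>2 = tensor_map R A A \<psi> \<psi>"

lemma \<psi>2_linear: "\<psi>\<^sub>2 \<in> linear_maps R T A.T"
  unfolding \<psi>\<^sub>2_def by (intro tensor_map_linear modA A.modA \<psi>)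

lemma \<psi>2_pure: "a \<in> carrier H \<Longrightarrow> b \<in> carrier H \<Longrightarrow> \<psi>\<^sub>2 (pure a b) = A.pure (\<psi> a) (\<psi> b)"
  by (simp add: \<psi>\<^sub>2_def tensor_map_pure modA A.modA \<psi>)

lemmas \<psi>2_simps = linear_maps_simps[OF \<psi>2_linear] \<psi>2_pure

text \<open>Together with \<open>\<psi>2_right_act\<close> this makes \<open>\<psi>\<^sub>2\<close>
  a bimodule map along \<open>\<psi>\<close>, which carries the derivation rule from forests to the
  target.\<close>

lemma \<psi>2_left_act:
  "t \<in> carrier T \<Longrightarrow> a \<in> carrier H \<Longrightarrow> \<psi>\<^sub>2 (left_act R H a t) = left_act R A (\<psi> a) (\<psi>\<^sub>2 t)"
  by (induction t rule: T_induct)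
    (simp_all add: left_act_pure A.left_act_pure \<psi>2_simps \<psi>_simps \<psi>_mult act_simps A.act_simps)

lemma \<psi>2_right_act:
  "t \<in> carrier T \<Longrightarrow> a \<in> carrier H \<Longrightarrow> \<psi>\<^sub>2 (right_act R H t a) = right_act R A (\<psi>\<^sub>2 t) (\<psi> a)"
  by (induction t rule: T_induct)
    (simp_all add: right_act_pure A.right_act_pure \<psi>2_simps \<psi>_simps \<psi>_mult act_simps A.act_simps)

text \<open>Both composites are tensor maps, with second factors \<psi> after grafting and
  \<open>P\<close> after \<psi>. These functions are known to agree only on the carrier, hence
  \<open>tensor_map_cong\<close> in place of rewriting.\<close>

lemma \<psi>2_Bp2:
  assumes "t \<in> carrier T"
  shows "\<psi>\<^sub>2 (Bp\<^sub>2 t) = tensor_map R A A id P (\<psi>\<^sub>2 t)"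
  unfolding \<psi>\<^sub>2_def Bp\<^sub>2_def
  by (simp add: tensor_map_comp[OF modA modA modA modA A.modA A.modA linear_maps_id Bp_linear \<psi> \<psi> assms]
      tensor_map_comp[OF modA modA A.modA A.modA A.modA A.modA \<psi> \<psi> linear_maps_id P_linear assms]
      del: id_apply)
    (rule tensor_map_cong[OF modA modA A.modA A.modA linear_maps_comp[OF linear_maps_id \<psi>]
        linear_maps_comp[OF Bp_linear \<psi>] _ _ assms]; simp add: \<psi>_Bp)

lemma \<psi>_comult_e: "u \<in> B \<Longrightarrow> \<Delta> (\<psi> (e u)) = \<psi>\<^sub>2 (D (e u))"
proof (induction u rule: forests_induct)
  case Nil
  then show ?case
    using linear_maps_zero[OF modT A.modT \<psi>2_linear] by (simp add: \<psi>_e D_e forests_Nil A.comult_one)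
next
  case (leaf x)
  then show ?case
    by (simp add: \<psi>_e D_e F_leaf Df_leaf forests_leaf comult_f \<psi>2_simps \<psi>_one one_closed
        del: forest_map.simps Delta_forest.simps)
next
  case (graft u)
  have "\<Delta> (\<psi> (Bp (e u))) = \<psi>\<^sub>2 (D (Bp (e u)))"
    using graft
    by (simp add: \<psi>_Bp A.cocycle D_cocycle \<psi>_simps \<psi>2_simps pure_simps \<psi>2_Bp2 \<psi>_one
        D_simps linear_maps_simps[OF Bp2_linear] e_closed one_closed)
  then show ?case using graft by (simp add: Bp_e)
next
  case (Cons t u)
  then have "\<Delta> (\<psi> (e [t] \<otimes>\<^bsub>H\<^esub> e u)) = \<psi>\<^sub>2 (D (e [t] \<otimes>\<^bsub>H\<^esub> e u))"
    by (simp add: \<psi>_mult A.comult_mult D_mult \<psi>_simps \<psi>2_simps act_simps D_simps e_closed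
        \<psi>2_left_act \<psi>2_right_act)
  then show ?case using Cons by (simp add: e_mult_e)
qed

lemma \<psi>_comult: "a \<in> carrier H \<Longrightarrow> \<Delta> (\<psi> a) = \<psi>\<^sub>2 (D a)"
  by (induction a rule: H_induct)
    (simp_all add: \<psi>_comult_e \<psi>_simps D_simps \<psi>2_simps A.comult_simps)

lemma forest_map_morphism: "operated_eps_morphism R H D Bp A \<Delta> P \<psi>"
  unfolding operated_eps_morphism_def
  using \<psi> \<psi>_Bp \<psi>_comult
  by (auto simp: \<psi>\<^sub>2_def ring_hom_def \<psi>_mult \<psi>_one \<psi>_simps)

end

lemma ex1_morphism:
  "\<exists>!\<psi>. \<psi> \<in> extensional (carrier H) \<and> operated_eps_morphism R H D Bp A \<Delta> P \<psi> \<and>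
    (\<forall>x\<in>X. \<psi> (single_vertex R x) = f x)"
proof (rule ex1I)
  \<comment> \<open>Restriction makes the linear extension extensional; the preceding results apply
    to it because they ask only for linearity on the carrier and the values on basis
    forests.\<close>
  let ?\<psi> = "restrict (lin_ext R A F) (carrier H)"
  have ext: "lin_ext R A F \<in> linear_maps R H A"
    by (intro ext_linear A.modA F_closed)
  have lin: "?\<psi> \<in> linear_maps R H A"
    by (rule linear_maps_cong[OF ext _ modH]) simp
  have e: "?\<psi> (e u) = F u" if "u \<in> B" for u
    using that by (simp add: e_closed ext_e A.modA F_closed)
  show "?\<psi> \<in> extensional (carrier H) \<and> operated_eps_morphism R H D Bp A \<Delta> P ?\<psi> \<and>
      (\<forall>x\<in>X. ?\<psi> (single_vertex R x) = f x)"
    using forest_map_morphism[OF lin e]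
    by (simp add: single_vertex_def e forests_leaf F_leaf del: restrict_apply forest_map.simps)
  fix \<psi> assume \<psi>: "\<psi> \<in> extensional (carrier H) \<and> operated_eps_morphism R H D Bp A \<Delta> P \<psi> \<and>
      (\<forall>x\<in>X. \<psi> (single_vertex R x) = f x)"
  then have \<psi>_lin: "\<psi> \<in> linear_maps R H A" by (simp add: operated_eps_morphism_def)
  show "\<psi> = ?\<psi>"
  proof (rule extensionalityI)
    have eq: "\<psi> (e u) = ?\<psi> (e u)" if "u \<in> B" for u
      unfolding e[OF that] using \<psi> that by (intro morphism_eq_forest_map) auto
    fix c assume "c \<in> carrier H"
    then have c: "c \<in> carrier (free_module R B)" by (simp add: H_alg_simps)
    show "\<psi> c = ?\<psi> c"
      by (rule linear_maps_free_eqI[OF A.modA \<psi>_lin[unfolded linear_maps_H_alg]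
            lin[unfolded linear_maps_H_alg] eq c])
  qed (use \<psi> in simp_all)
qed

end

theorem theorem2p17:
  fixes R :: "('r, 'q) ring_scheme" and X :: "'x set" and \<sigma> :: 'x
  assumes "cring R" and "\<sigma> \<notin> X"
  shows "free_cocycle_eps_unitary_bialgebra TYPE('h) R X
    (H_alg R X \<sigma>) (Delta_eps R X \<sigma>) (B_plus R X \<sigma>) (single_vertex R)"
proof -
  interpret forest_algebra R X \<sigma> by (rule forest_algebra.intro assms)+
  show ?thesis
    unfolding free_cocycle_eps_unitary_bialgebra_def
  proof (intro conjI allI impI)
    show "cocycle_eps_unitary_bialgebra R H D Bp" by (rule H_cocycle_bialgebra)
    show "single_vertex R \<in> X \<rightarrow> carrier H"
      by (auto simp: single_vertex_def e_closed forests_leaf)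
  next
    fix A :: "('r, 'h) module" and \<Delta> P f
    assume "cocycle_eps_unitary_bialgebra R A \<Delta> P" "f \<in> X \<rightarrow> carrier A"
      and "\<forall>x\<in>X. \<Delta> (f x) = pure_tensor R A A \<one>\<^bsub>A\<^esub> \<one>\<^bsub>A\<^esub>"
    then interpret cocycle_target R X \<sigma> A \<Delta> P f
      by (intro cocycle_target.intro forest_algebra_axioms cocycle_target_axioms.intro) auto
    show "\<exists>!\<psi>. \<psi> \<in> extensional (carrier H) \<and> operated_eps_morphism R H D Bp A \<Delta> P \<psi> \<and>
        (\<forall>x\<in>X. \<psi> (single_vertex R x) = f x)"
      by (rule ex1_morphism)
  qed
qed

end
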